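(* Let $(G,P)$ be a quasi-lattice ordered group. Then the full semigroup C*-algebra $C^*(P)$ and Nica's C*-algebra $C^*(G,P)$ are canonically isomorphic, via the isomorphism $C^*(P)\to C^*(G,P)$ determined by $v_p\mapsto v(p)$ for all $p\in P$, $e_\emptyset\mapsto 0$ and $e_{pP}\mapsto v(p)v(p)^*$ for all $p\in P$, whose inverse is determined by $v(p)\mapsto v_p$.
   Context: A quasi-lattice ordered group is a pair $(G,P)$ where $P$ is a subsemigroup (containing the unit $e$) of a discrete group $G$ with $P\cap P^{-1}=\{e\}$ such that for all $n\geq 1$ and $x_1,\dots,x_n\in G$ the set $P\cap\bigcap_{i=1}^n (x_i\cdot P)$ is either empty or of the form $pP$ for some $p\in P$; here $x\cdot P=\{xp:p\in P\}\subseteq G$. For $X\subseteq P$, $p\in P$ put $pX=\{px:x\in X\}$ and $p^{-1}X=\{y\in P:py\in X\}$. $\mathcal J$ is the smallest family of right ideals of $P$ containing $P$ and $\emptyset$, closed under $X\mapsto pX$, $X\mapsto p^{-1}X$ ($p\in P$) and finite intersections. In the quasi-lattice ordered case $\mathcal J=\{pP:p\in P\}\cup\{\emptyset\}$. $C^*(P)$ is the universal C*-algebra generated by isometries $\{v_p:p\in P\}$ and projections $\{e_X:X\in\mathcal J\}$ satisfying, for all $p,q\in P$, $X,Y\in\mathcal J$: $v_{pq}=v_pv_q$, $v_pe_Xv_p^*=e_{pX}$, $e_P=1$, $e_\emptyset=0$, $e_{X\cap Y}=e_Xe_Y$. $C^*(G,P)$ is the universal C*-algebra generated by isometries $\{v(p):p\in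 P\}$ subject to the relations, for all $p,q\in P$: $v(p)v(q)=v(pq)$, and $v(p)v(p)^*v(q)v(q)^*=v(r)v(r)^*$ if $pP\cap qP=rP$ for some $r\in P$, and $v(p)v(p)^*v(q)v(q)^*=0$ if $pP\cap qP=\emptyset$. *)

theory Defs
  imports Complex_Main "HOL-Library.Poly_Mapping" "HOL-Algebra.QuotRing" "HOL-Algebra.Module"
begin

section \<open>Unital C*-algebras\<close>

definition complex_field :: "complex ring"
  where "complex_field = \<lparr>carrier = UNIV, mult = (*), one = 1, zero = 0, add = (+)\<rparr>"

record 'a star_algebra = "(complex, 'a) module" +
  star :: "'a \<Rightarrow> 'a"
  nrm :: "'a \<Rightarrow> real"

locale cstar_algebra = ring A + scal: module complex_field A for A :: "'a star_algebra" (structure) +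
  assumes smult_mult_left:
      "\<lbrakk>x \<in> carrier A; y \<in> carrier A\<rbrakk> \<Longrightarrow> (c \<odot> x) \<otimes> y = c \<odot> (x \<otimes> y)"
    and smult_mult_right:
      "\<lbrakk>x \<in> carrier A; y \<in> carrier A\<rbrakk> \<Longrightarrow> x \<otimes> (c \<odot> y) = c \<odot> (x \<otimes> y)"
    and star_closed: "x \<in> carrier A \<Longrightarrow> star A x \<in> carrier A"
    and star_star: "x \<in> carrier A \<Longrightarrow> star A (star A x) = x"
    and star_add:
      "\<lbrakk>x \<in> carrier A; y \<in> carrier A\<rbrakk> \<Longrightarrow> star A (x \<oplus> y) = star A x \<oplus> star A y"
    and star_smult: "x \<in> carrier A \<Longrightarrow> star A (c \<odot> x) = cnj c \<odot> star A x"
    and star_mult: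
      "\<lbrakk>x \<in> carrier A; y \<in> carrier A\<rbrakk> \<Longrightarrow> star A (x \<otimes> y) = star A y \<otimes> star A x"
    and nrm_nonneg: "x \<in> carrier A \<Longrightarrow> 0 \<le> nrm A x"
    and nrm_eq_0_iff: "x \<in> carrier A \<Longrightarrow> nrm A x = 0 \<longleftrightarrow> x = \<zero>"
    and nrm_triangle:
      "\<lbrakk>x \<in> carrier A; y \<in> carrier A\<rbrakk> \<Longrightarrow> nrm A (x \<oplus> y) \<le> nrm A x + nrm A y"
    and nrm_smult: "x \<in> carrier A \<Longrightarrow> nrm A (c \<odot> x) = cmod c * nrm A x"
    and nrm_mult:
      "\<lbrakk>x \<in> carrier A; y \<in> carrier A\<rbrakk> \<Longrightarrow> nrm A (x \<otimes> y) \<le> nrm A x * nrm A y"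
    and nrm_star_mult: "x \<in> carrier A \<Longrightarrow> nrm A (star A x \<otimes> x) = (nrm A x)\<^sup>2"
    and complete:
      "\<lbrakk>\<And>n. s n \<in> carrier A; \<And>\<epsilon>. 0 < \<epsilon> \<Longrightarrow> \<exists>N. \<forall>m\<ge>N. \<forall>n\<ge>N. nrm A (s m \<ominus> s n) < \<epsilon>\<rbrakk>
        \<Longrightarrow> \<exists>x\<in>carrier A. (\<lambda>n. nrm A (s n \<ominus> x)) \<longlonglongrightarrow> 0"

definition star_hom :: "'a star_algebra \<Rightarrow> 'b star_algebra \<Rightarrow> ('a \<Rightarrow> 'b) set"
  where "star_hom A B = {\<phi> \<in> ring_hom A B. \<forall>x\<in>carrier A.
    (\<forall>c. \<phi> (c \<odot>\<^bsub>A\<^esub> x) = c \<odot>\<^bsub>B\<^esub> \<phi> x) \<and> \<phi> (star A x) = star B (\<phi> x)}"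

definition star_iso :: "'a star_algebra \<Rightarrow> 'b star_algebra \<Rightarrow> ('a \<Rightarrow> 'b) set"
  where "star_iso A B = {\<phi> \<in> star_hom A B. bij_betw \<phi> (carrier A) (carrier B)}"


section \<open>The free unital *-algebra\<close>

datatype 'x letter = Gen (base: 'x) | Adj (base: 'x)

primrec flip :: "'x letter \<Rightarrow> 'x letter"
  where "flip (Gen x) = Adj x" | "flip (Adj x) = Gen x"

datatype 'x word = Word (letters: "'x letter list")

instantiation word :: (type) monoid_add
begin

definition zero_word :: "'a word" where "0 = Word []"

definition plus_word :: "'a word \<Rightarrow> 'a word \<Rightarrow> 'a word"
  where "v + w = Word (letters v @ letters w)"

instance
  by standard (simp_all add: zero_word_def plus_word_def)

end

text \<open>
  The product of finitely supported functions on a monoid, written additively in the library,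
  is convolution. Hence the type \<open>'x word \<Rightarrow>\<^sub>0 complex\<close> with its ring structure is the free unital
  complex algebra on the letters \<open>Gen x\<close> and \<open>Adj x\<close>; \<open>free_star_algebra X\<close> is the subalgebra
  generated by the letters with \<open>x \<in> X\<close>.
\<close>

type_synonym 'x free_star = "'x word \<Rightarrow>\<^sub>0 complex"

definition free_star_algebra :: "'x set \<Rightarrow> 'x free_star set"
  where "free_star_algebra X = {f. \<forall>w\<in>Poly_Mapping.keys f. base ` set (letters w) \<subseteq> X}"

definition gen :: "'x \<Rightarrow> 'x free_star"
  where "gen x = Poly_Mapping.single (Word [Gen x]) 1"

definition cst :: "complex \<Rightarrow> 'x free_star"
  where "cst c = Poly_Mapping.single 0 c"

definition word_adj :: "'x word \<Rightarrow> 'x word"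
  where "word_adj w = Word (rev (map flip (letters w)))"

definition adj :: "'x free_star \<Rightarrow> 'x free_star"
  where "adj f = Poly_Mapping.map cnj (Poly_Mapping.map_key word_adj f)"


section \<open>Universal C*-algebras\<close>

text \<open>
  The universal unital C*-algebra generated by \<open>X\<close> subject to the relations \<open>r = 0\<close>, \<open>r \<in> R\<close>, is
  the Hausdorff completion of the free unital *-algebra on \<open>X\<close> in the largest C*-seminorm that
  vanishes on \<open>R\<close>. It is realised as the ring of Cauchy sequences modulo the ideal of null
  sequences. The supremum is finite if the seminorms in question are bounded on each generator.
\<close>

definition cstar_seminorm :: "'x set \<Rightarrow> ('x free_star \<Rightarrow> real) \<Rightarrow> bool"
  where "cstar_seminorm X p \<longleftrightarrow>
    (\<forall>a\<in>free_star_algebra X. 0 \<le> p a \<and> (\<forall>c. p (cst c * a) = cmod c * p a) \<and>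
      p (adj a * a) = (p a)\<^sup>2 \<and>
      (\<forall>b\<in>free_star_algebra X. p (a + b) \<le> p a + p b \<and> p (a * b) \<le> p a * p b))"

definition admissible :: "'x set \<Rightarrow> 'x free_star set \<Rightarrow> ('x free_star \<Rightarrow> real) \<Rightarrow> bool"
  where "admissible X R p \<longleftrightarrow> cstar_seminorm X p \<and> (\<forall>r\<in>R. p r = 0)"

definition universal_nrm :: "'x set \<Rightarrow> 'x free_star set \<Rightarrow> 'x free_star \<Rightarrow> real"
  where "universal_nrm X R a = Sup {p a | p. admissible X R p}"

definition cauchy_ring :: "'x set \<Rightarrow> 'x free_star set \<Rightarrow> (nat \<Rightarrow> 'x free_star) ring"
  where "cauchy_ring X R =
    \<lparr>carrier = {s. range s \<subseteq> free_star_algebra X \<and>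
        (\<forall>\<epsilon>>0. \<exists>N. \<forall>m\<ge>N. \<forall>n\<ge>N. universal_nrm X R (s m - s n) < \<epsilon>)},
      mult = (\<lambda>s t n. s n * t n), one = (\<lambda>n. 1),
      zero = (\<lambda>n. 0), add = (\<lambda>s t n. s n + t n)\<rparr>"

definition null_sequences :: "'x set \<Rightarrow> 'x free_star set \<Rightarrow> (nat \<Rightarrow> 'x free_star) set"
  where "null_sequences X R =
    {s. range s \<subseteq> free_star_algebra X \<and> (\<lambda>n. universal_nrm X R (s n)) \<longlonglongrightarrow> 0}"

definition coset :: "'x set \<Rightarrow> 'x free_star set \<Rightarrow> (nat \<Rightarrow> 'x free_star) \<Rightarrow> (nat \<Rightarrow> 'x free_star) set"
  where "coset X R s = null_sequences X R +>\<^bsub>cauchy_ring X R\<^esub> s"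

definition universal_cstar :: "'x set \<Rightarrow> 'x free_star set \<Rightarrow> (nat \<Rightarrow> 'x free_star) set star_algebra"
  where "universal_cstar X R = (let Q = cauchy_ring X R Quot null_sequences X R in
    \<lparr>carrier = carrier Q, mult = mult Q, one = one Q, zero = zero Q, add = add Q,
      smult = (\<lambda>c Z. \<Union>s\<in>Z. coset X R (\<lambda>n. cst c * s n)),
      star = (\<lambda>Z. \<Union>s\<in>Z. coset X R (\<lambda>n. adj (s n))),
      nrm = (\<lambda>Z. THE r. \<forall>s\<in>Z. (\<lambda>n. universal_nrm X R (s n)) \<longlonglongrightarrow> r)\<rparr>)"

definition universal_gen :: "'x set \<Rightarrow> 'x free_star set \<Rightarrow> 'x \<Rightarrow> (nat \<Rightarrow> 'x free_star) set"
  where "universal_gen X R x = coset X R (\<lambda>n. gen x)"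


section \<open>Quasi-lattice ordered groups and their C*-algebras\<close>

locale quasi_lattice_ordered = group G for G (structure) +
  fixes P :: "'a set"
  assumes subset: "P \<subseteq> carrier G"
    and one_mem: "\<one> \<in> P"
    and mult_mem: "\<lbrakk>p \<in> P; q \<in> P\<rbrakk> \<Longrightarrow> p \<otimes> q \<in> P"
    and inverses: "P \<inter> (\<lambda>p. inv p) ` P = {\<one>}"
    and quasi_lattice: "\<lbrakk>1 \<le> (n::nat); \<And>i. i \<in> {1..n} \<Longrightarrow> x i \<in> carrier G\<rbrakk> \<Longrightarrow>
      P \<inter> (\<Inter>i\<in>{1..n}. x i <# P) = {} \<or> (\<exists>p\<in>P. P \<inter> (\<Inter>i\<in>{1..n}. x i <# P) = p <# P)"

inductive_set constructible_ideals :: "('g, 'm) monoid_scheme \<Rightarrow> 'g set \<Rightarrow> 'g set set"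
  for G P
  where
    whole: "P \<in> constructible_ideals G P"
  | empty: "{} \<in> constructible_ideals G P"
  | translate: "\<lbrakk>X \<in> constructible_ideals G P; p \<in> P\<rbrakk> \<Longrightarrow> p <#\<^bsub>G\<^esub> X \<in> constructible_ideals G P"
  | preimage: "\<lbrakk>X \<in> constructible_ideals G P; p \<in> P\<rbrakk> \<Longrightarrow>
      {y \<in> P. p \<otimes>\<^bsub>G\<^esub> y \<in> X} \<in> constructible_ideals G P"
  | inter: "\<lbrakk>X \<in> constructible_ideals G P; Y \<in> constructible_ideals G P\<rbrakk> \<Longrightarrow>
      X \<inter> Y \<in> constructible_ideals G P"

datatype 'g semigroup_gen = V 'g | E "'g set"

definition semigroup_gens :: "('g, 'm) monoid_scheme \<Rightarrow> 'g set \<Rightarrow> 'g semigroup_gen set"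
  where "semigroup_gens G P = V ` P \<union> E ` constructible_ideals G P"

definition semigroup_rels ::
    "('g, 'm) monoid_scheme \<Rightarrow> 'g set \<Rightarrow> 'g semigroup_gen free_star set"
  where "semigroup_rels G P = (let v = (\<lambda>p. gen (V p)); e = (\<lambda>X. gen (E X)); J = constructible_ideals G P in
      {adj (v p) * v p - 1 | p. p \<in> P}
    \<union> {adj (e X) - e X | X. X \<in> J}
    \<union> {e X * e X - e X | X. X \<in> J}
    \<union> {v (p \<otimes>\<^bsub>G\<^esub> q) - v p * v q | p q. p \<in> P \<and> q \<in> P}
    \<union> {v p * e X * adj (v p) - e (p <#\<^bsub>G\<^esub> X) | p X. p \<in> P \<and> X \<in> J}
    \<union> {e P - 1, e {}}
    \<union> {e (X \<inter> Y) - e X * e Y | X Y. X \<in> J \<and> Y \<in> J})"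

abbreviation full_semigroup_cstar
  where "full_semigroup_cstar G P \<equiv> universal_cstar (semigroup_gens G P) (semigroup_rels G P)"

abbreviation semigroup_v
  where "semigroup_v G P p \<equiv> universal_gen (semigroup_gens G P) (semigroup_rels G P) (V p)"

abbreviation semigroup_e
  where "semigroup_e G P X \<equiv> universal_gen (semigroup_gens G P) (semigroup_rels G P) (E X)"

definition nica_rels :: "('g, 'm) monoid_scheme \<Rightarrow> 'g set \<Rightarrow> 'g free_star set"
  where "nica_rels G P =
      {adj (gen p) * gen p - 1 | p. p \<in> P}
    \<union> {gen p * gen q - gen (p \<otimes>\<^bsub>G\<^esub> q) | p q. p \<in> P \<and> q \<in> P}
    \<union> {gen p * adj (gen p) * (gen q * adj (gen q)) - gen r * adj (gen r) | p q r.
        p \<in> P \<and> q \<in> P \<and> r \<in> P \<and> (p <#\<^bsub>G\<^esub> P) \<inter> (q <#\<^bsub>G\<^esub> P) = r <#\<^bsub>G\<^esub> P}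
    \<union> {gen p * adj (gen p) * (gen q * adj (gen q)) | p q.
        p \<in> P \<and> q \<in> P \<and> (p <#\<^bsub>G\<^esub> P) \<inter> (q <#\<^bsub>G\<^esub> P) = {}}"

abbreviation nica_cstar
  where "nica_cstar G P \<equiv> universal_cstar P (nica_rels G P)"

abbreviation nica_v
  where "nica_v G P p \<equiv> universal_gen P (nica_rels G P) p"

section \<open>The universal property\<close>

text \<open>
  The construction above is justified here: if the admissible seminorms are bounded on every
  generator, then \<open>universal_cstar X R\<close> is a C*-algebra in which the relations hold
  (\<open>cstar_algebra_universal\<close>, \<open>universal_rels\<close>), the *-polynomials in the generators are dense
  (\<open>universal_dense\<close>), and every family in a C*-algebra that satisfies the relations is the image
  of the generators under a *-homomorphism (\<open>universal_ex\<close>). Both presentations of a quasi-lattice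
  ordered group are bounded (\<open>bounded_presentation_semigroup\<close>, \<open>bounded_presentation_nica\<close>).
\<close>

lemma flip_flip [simp]: "flip (flip l) = l"
  by (cases l) simp_all

lemma base_flip [simp]: "base (flip l) = base l"
  by (cases l) simp_all

lemma word_adj_adj [simp]: "word_adj (word_adj w) = w"
  by (cases w) (simp add: word_adj_def rev_map comp_def)

lemma word_adj_add: "word_adj (v + w) = word_adj w + word_adj v"
  by (simp add: word_adj_def plus_word_def)

lemma word_adj_0 [simp]: "word_adj 0 = 0"
  by (simp add: word_adj_def zero_word_def)

lemma inj_word_adj: "inj word_adj"
  by (metis injI word_adj_adj)

lemma lookup_adj: "Poly_Mapping.lookup (adj f) w = cnj (Poly_Mapping.lookup f (word_adj w))"
  by (simp add: adj_def Poly_Mapping.map.rep_eq map_key.rep_eq[OF inj_word_adj] when_def)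

lemma adj_adj [simp]: "adj (adj f) = f"
  by (rule poly_mapping_eqI) (simp add: lookup_adj)

lemma adj_add: "adj (f + g) = adj f + adj g"
  by (rule poly_mapping_eqI) (simp add: lookup_adj lookup_add)

lemma adj_minus: "adj (f - g) = adj f - adj g"
  by (rule poly_mapping_eqI) (simp add: lookup_adj lookup_minus)

lemma adj_0 [simp]: "adj 0 = 0"
  by (rule poly_mapping_eqI) (simp add: lookup_adj)

lemma adj_single: "adj (Poly_Mapping.single w c) = Poly_Mapping.single (word_adj w) (cnj c)"
  by (rule poly_mapping_eqI) (auto simp add: lookup_adj lookup_single when_def)

lemma adj_cst [simp]: "adj (cst c) = cst (cnj c)"
  by (simp add: cst_def adj_single)

lemma free_star_add_induct [case_names zero add]:
  assumes "P 0"
    and step: "\<And>w c f. \<lbrakk>w \<notin> Poly_Mapping.keys f; c \<noteq> 0; P f\<rbrakk> \<Longrightarrow> P (Poly_Mapping.single w c + f)"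
  shows "P (f :: 'x free_star)"
proof (induction f rule: update_induct)
  case const
  show ?case by fact
next
  case (update f w c)
  have "Poly_Mapping.update w c f = Poly_Mapping.single w c + f"
    using update(1) by (intro poly_mapping_eqI)
      (auto simp: lookup_update lookup_add lookup_single in_keys_iff when_def)
  with update step show ?case by metis
qed

lemma adj_mult: "adj (f * g) = adj g * adj f"
proof (induction f rule: free_star_add_induct)
  case (add v c f)
  have "adj (Poly_Mapping.single v c * g) = adj g * adj (Poly_Mapping.single v c)"
  proof (induction g rule: free_star_add_induct)
    case (add w d g)
    then show ?case
      by (simp add: distrib_left distrib_right adj_add mult_single adj_single word_adj_add mult.commute)
  qed simp
  with add show ?case by (simp add: distrib_left distrib_right adj_add)
qed simp

lemma cst_0 [simp]: "cst 0 = 0" and cst_1 [simp]: "cst 1 = 1"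
  and cst_add: "cst (c + d) = cst c + cst d" and cst_mult: "cst (c * d) = cst c * cst d"
  by (simp_all add: cst_def single_add mult_single)

lemma cst_minus_1: "cst (-1) * f = - f"
  by (simp add: cst_def single_uminus)

lemma cst_central: "f * cst c = cst c * f"
  by (induction f rule: free_star_add_induct)
    (simp_all add: distrib_left distrib_right mult_single cst_def mult.commute)

lemma adj_1 [simp]: "adj 1 = 1"
  using adj_cst[of 1] by (simp del: adj_cst)


lemma free_0 [simp]: "0 \<in> free_star_algebra X"
  by (simp add: free_star_algebra_def)

lemma free_cst [simp]: "cst c \<in> free_star_algebra X"
  by (simp add: free_star_algebra_def cst_def zero_word_def)

lemma free_1 [simp]: "1 \<in> free_star_algebra X"
  using free_cst[of 1] by simp

lemma free_gen [simp]: "x \<in> X \<Longrightarrow> gen x \<in> free_star_algebra X"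
  by (simp add: free_star_algebra_def gen_def)

lemma free_add [simp]:
  "\<lbrakk>f \<in> free_star_algebra X; g \<in> free_star_algebra X\<rbrakk> \<Longrightarrow> f + g \<in> free_star_algebra X"
  using Poly_Mapping.keys_add[of f g] unfolding free_star_algebra_def by blast

lemma free_mult [simp]:
  "\<lbrakk>f \<in> free_star_algebra X; g \<in> free_star_algebra X\<rbrakk> \<Longrightarrow> f * g \<in> free_star_algebra X"
  using keys_mult[of f g] unfolding free_star_algebra_def
  by (fastforce simp: plus_word_def)

lemma free_uminus [simp]: "f \<in> free_star_algebra X \<Longrightarrow> - f \<in> free_star_algebra X"
  by (metis cst_minus_1 free_cst free_mult)

lemma free_minus [simp]:
  "\<lbrakk>f \<in> free_star_algebra X; g \<in> free_star_algebra X\<rbrakk> \<Longrightarrow> f - g \<in> free_star_algebra X"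
  by (metis add_uminus_conv_diff free_add free_uminus)

lemma free_adj [simp]: "f \<in> free_star_algebra X \<Longrightarrow> adj f \<in> free_star_algebra X"
proof -
  assume f: "f \<in> free_star_algebra X"
  have "base ` set (letters w) \<subseteq> X" if "w \<in> Poly_Mapping.keys (adj f)" for w
  proof -
    from that have "word_adj w \<in> Poly_Mapping.keys f"
      by (simp add: in_keys_iff lookup_adj)
    with f have "base ` set (letters (word_adj w)) \<subseteq> X"
      by (simp add: free_star_algebra_def)
    then show ?thesis by (simp add: word_adj_def image_image)
  qed
  then show ?thesis by (simp add: free_star_algebra_def)
qed

lemma free_induct [consumes 1, case_names cst gen adj add mult]:
  assumes f: "f \<in> free_star_algebra X"
    and cst: "\<And>c. P (cst c)" and gen: "\<And>x. x \<in> X \<Longrightarrow> P (gen x)"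
    and adj: "\<And>x. x \<in> X \<Longrightarrow> P (adj (gen x))"
    and add: "\<And>f g. \<lbrakk>f \<in> free_star_algebra X; g \<in> free_star_algebra X; P f; P g\<rbrakk> \<Longrightarrow> P (f + g)"
    and mult: "\<And>f g. \<lbrakk>f \<in> free_star_algebra X; g \<in> free_star_algebra X; P f; P g\<rbrakk> \<Longrightarrow> P (f * g)"
  shows "P f"
proof -
  have word: "Poly_Mapping.single (Word ls) 1 \<in> free_star_algebra X \<and> P (Poly_Mapping.single (Word ls) 1)"
    if "base ` set ls \<subseteq> X" for ls
    using that
  proof (induction ls)
    case Nil
    have "Poly_Mapping.single (Word []) 1 = cst 1"
      by (simp add: cst_def zero_word_def)
    then show ?case by (metis cst free_cst)
  next
    case (Cons l ls)
    let ?l = "Poly_Mapping.single (Word [l]) (1::complex)"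
    have "?l \<in> free_star_algebra X \<and> P ?l"
    proof (cases l)
      case (Gen x)
      with Cons.prems gen[of x] free_gen[of x X] show ?thesis by (simp add: gen_def)
    next
      case (Adj x)
      have "adj (gen x) = ?l" by (simp add: gen_def adj_single word_adj_def Adj)
      with Cons.prems adj[of x] free_adj[OF free_gen[of x X]] Adj show ?thesis by simp
    qed
    moreover have "Poly_Mapping.single (Word (l # ls)) 1 = ?l * Poly_Mapping.single (Word ls) 1"
      by (simp add: mult_single plus_word_def)
    ultimately show ?case using Cons mult by simp
  qed
  have single: "Poly_Mapping.single w c \<in> free_star_algebra X \<and> P (Poly_Mapping.single w c)"
    if "base ` set (letters w) \<subseteq> X" for w c
  proof -
    have "Poly_Mapping.single w c = cst c * Poly_Mapping.single (Word (letters w)) 1"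
      by (simp add: cst_def mult_single)
    with word[OF that] mult cst[of c] show ?thesis by (metis free_cst free_mult)
  qed
  from f show ?thesis
  proof (induction f rule: free_star_add_induct)
    case zero
    then show ?case using cst[of 0] by simp
  next
    case (add w c f)
    have keys: "Poly_Mapping.keys (Poly_Mapping.single w c + f) = insert w (Poly_Mapping.keys f)"
      using add by (auto simp: in_keys_iff lookup_add lookup_single when_def split: if_splits)
    with add.prems have "base ` set (letters w) \<subseteq> X" "f \<in> free_star_algebra X"
      by (auto simp: free_star_algebra_def)
    with add.IH single assms(5) show ?case by blast
  qed
qed


context
  fixes X :: "'x set" and p :: "'x free_star \<Rightarrow> real"
  assumes p: "cstar_seminorm X p"
begin

lemma seminorm_nonneg: "a \<in> free_star_algebra X \<Longrightarrow> 0 \<le> p a"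
  and seminorm_cst: "a \<in> free_star_algebra X \<Longrightarrow> p (cst c * a) = cmod c * p a"
  and seminorm_star: "a \<in> free_star_algebra X \<Longrightarrow> p (adj a * a) = (p a)\<^sup>2"
  and seminorm_add: "\<lbrakk>a \<in> free_star_algebra X; b \<in> free_star_algebra X\<rbrakk> \<Longrightarrow> p (a + b) \<le> p a + p b"
  and seminorm_mult: "\<lbrakk>a \<in> free_star_algebra X; b \<in> free_star_algebra X\<rbrakk> \<Longrightarrow> p (a * b) \<le> p a * p b"
  using p by (auto simp: cstar_seminorm_def)

lemma seminorm_0: "p 0 = 0"
  using seminorm_cst[of 0 0] by simp

lemma seminorm_uminus: "a \<in> free_star_algebra X \<Longrightarrow> p (- a) = p a"
  using seminorm_cst[of a "-1"] by (simp add: cst_minus_1)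

lemma seminorm_minus:
  "\<lbrakk>a \<in> free_star_algebra X; b \<in> free_star_algebra X\<rbrakk> \<Longrightarrow> p (a - b) \<le> p a + p b"
  using seminorm_add[of a "-b"] by (simp add: seminorm_uminus)

lemma seminorm_minus_commute:
  "\<lbrakk>a \<in> free_star_algebra X; b \<in> free_star_algebra X\<rbrakk> \<Longrightarrow> p (a - b) = p (b - a)"
  using seminorm_uminus[of "a - b"] by simp

lemma seminorm_diff_abs:
  "\<lbrakk>a \<in> free_star_algebra X; b \<in> free_star_algebra X\<rbrakk> \<Longrightarrow> \<bar>p a - p b\<bar> \<le> p (a - b)"
  using seminorm_add[of "a - b" b] seminorm_add[of "b - a" a] by (simp add: seminorm_minus_commute)

lemma seminorm_1: "p 1 \<le> 1"
proof -
  have "p 1 = p 1 * p 1" using seminorm_star[of 1] by (simp add: power2_eq_square)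
  then show ?thesis by auto
qed

lemma seminorm_le_adj: "a \<in> free_star_algebra X \<Longrightarrow> p a \<le> p (adj a)"
proof -
  assume a: "a \<in> free_star_algebra X"
  have "p a * p a \<le> p (adj a) * p a"
    using seminorm_star[OF a] seminorm_mult[of "adj a" a] a by (simp add: power2_eq_square)
  then show ?thesis
    using seminorm_nonneg[OF a] seminorm_nonneg[OF free_adj[OF a]] by (cases "p a = 0") auto
qed

lemma seminorm_adj: "a \<in> free_star_algebra X \<Longrightarrow> p (adj a) = p a"
  using seminorm_le_adj[of a] seminorm_le_adj[of "adj a"] by simp

end


locale bounded_presentation =
  fixes X :: "'x set" and R :: "'x free_star set"
  assumes rels_free: "R \<subseteq> free_star_algebra X"
    and bounded_gen: "x \<in> X \<Longrightarrow> \<exists>M. \<forall>p. admissible X R p \<longrightarrow> p (gen x) \<le> M"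
begin

abbreviation "F \<equiv> free_star_algebra X"
abbreviation "u \<equiv> universal_nrm X R"

lemma bounded: "a \<in> F \<Longrightarrow> \<exists>M. \<forall>p. admissible X R p \<longrightarrow> p a \<le> M"
proof (induction a rule: free_induct)
  case (cst c)
  have "p (cst c) \<le> cmod c" if "admissible X R p" for p
  proof -
    from that have p: "cstar_seminorm X p" by (simp add: admissible_def)
    have "p (cst c) = cmod c * p 1" using seminorm_cst[OF p, of 1 c] by simp
    also have "\<dots> \<le> cmod c * 1" by (intro mult_left_mono seminorm_1[OF p]) simp
    finally show ?thesis by simp
  qed
  then show ?case by blast
next
  case (gen x)
  then show ?case by (rule bounded_gen)
next
  case (adj x)
  from bounded_gen[OF this] obtain M where "\<forall>p. admissible X R p \<longrightarrow> p (gen x) \<le> M" ..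
  then show ?case using adj by (metis admissible_def free_gen seminorm_adj)
next
  case (add f g)
  then obtain M N where "\<forall>p. admissible X R p \<longrightarrow> p f \<le> M" "\<forall>p. admissible X R p \<longrightarrow> p g \<le> N"
    by blast
  with add have "\<forall>p. admissible X R p \<longrightarrow> p (f + g) \<le> M + N"
    by (smt (verit) admissible_def seminorm_add)
  then show ?case ..
next
  case (mult f g)
  then obtain M N where MN: "\<forall>p. admissible X R p \<longrightarrow> p f \<le> M" "\<forall>p. admissible X R p \<longrightarrow> p g \<le> N"
    by blast
  have "p (f * g) \<le> M * N" if a: "admissible X R p" for p
  proof -
    from a have p: "cstar_seminorm X p" by (simp add: admissible_def)
    have "p (f * g) \<le> p f * p g" using seminorm_mult[OF p] mult by simp
    also have "\<dots> \<le> M * N"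
      using MN a seminorm_nonneg[OF p] mult.hyps by (intro mult_mono) (auto intro: order_trans)
    finally show ?thesis .
  qed
  then show ?case by blast
qed

lemma admissible_zero: "admissible X R (\<lambda>_. 0)"
  by (simp add: admissible_def cstar_seminorm_def)

lemma u_upper: "\<lbrakk>admissible X R p; a \<in> F\<rbrakk> \<Longrightarrow> p a \<le> u a"
  unfolding universal_nrm_def using bounded[of a] by (intro cSup_upper) (auto simp: bdd_above_def)

lemma u_least: "(\<And>p. admissible X R p \<Longrightarrow> p a \<le> M) \<Longrightarrow> u a \<le> M"
  unfolding universal_nrm_def using admissible_zero by (intro cSup_least) auto

lemma u_seminorm: "cstar_seminorm X u"
  unfolding cstar_seminorm_def
proof (intro ballI conjI allI)
  fix a assume a: "a \<in> F"
  show nonneg: "0 \<le> u a" if "a \<in> F" for a using u_upper[OF admissible_zero that] .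
  show "u (adj a * a) = (u a)\<^sup>2"
  proof (rule antisym)
    show "u (adj a * a) \<le> (u a)\<^sup>2"
    proof (rule u_least)
      fix p assume ad: "admissible X R p"
      then have p: "cstar_seminorm X p" by (simp add: admissible_def)
      show "p (adj a * a) \<le> (u a)\<^sup>2"
        using u_upper[OF ad a] seminorm_nonneg[OF p a] by (simp add: seminorm_star[OF p a] power_mono)
    qed
    have "u a \<le> sqrt (u (adj a * a))"
    proof (rule u_least)
      fix p assume ad: "admissible X R p"
      then have p: "cstar_seminorm X p" by (simp add: admissible_def)
      have "(p a)\<^sup>2 \<le> u (adj a * a)"
        using u_upper[OF ad, of "adj a * a"] a by (simp add: seminorm_star[OF p a])
      then show "p a \<le> sqrt (u (adj a * a))" by (rule real_le_rsqrt)
    qed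
    then show "(u a)\<^sup>2 \<le> u (adj a * a)"
      using nonneg[OF a] nonneg[of "adj a * a"] a
      by (metis free_adj free_mult power_mono real_sqrt_pow2)
  qed
  have cst_le: "u (cst c * a) \<le> cmod c * u a" if a: "a \<in> F" for c a
  proof (rule u_least)
    fix p assume ad: "admissible X R p"
    then have p: "cstar_seminorm X p" by (simp add: admissible_def)
    show "p (cst c * a) \<le> cmod c * u a"
      using u_upper[OF ad a] by (simp add: seminorm_cst[OF p a] mult_left_mono)
  qed
  show "u (cst c * a) = cmod c * u a" for c
  proof (cases "c = 0")
    case True
    then show ?thesis using cst_le[OF a, of 0] nonneg[of 0] by simp
  next
    case False
    have "u a = u (cst (inverse c) * (cst c * a))"
      using False by (simp add: mult.assoc[symmetric] cst_mult[symmetric])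
    also have "\<dots> \<le> cmod (inverse c) * u (cst c * a)" using a by (intro cst_le) simp
    finally have "cmod c * u a \<le> cmod c * (cmod (inverse c) * u (cst c * a))"
      by (rule mult_left_mono) simp
    then have "cmod c * u a \<le> u (cst c * a)"
      using False by (simp add: mult.assoc[symmetric] norm_mult[symmetric])
    with cst_le[OF a, of c] show ?thesis by simp
  qed
  fix b assume b: "b \<in> F"
  show "u (a + b) \<le> u a + u b"
  proof (rule u_least)
    fix p assume ad: "admissible X R p"
    then have p: "cstar_seminorm X p" by (simp add: admissible_def)
    show "p (a + b) \<le> u a + u b"
      using u_upper[OF ad a] u_upper[OF ad b] seminorm_add[OF p a b] by simp
  qed
  show "u (a * b) \<le> u a * u b"
  proof (rule u_least)
    fix p assume ad: "admissible X R p"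
    then have p: "cstar_seminorm X p" by (simp add: admissible_def)
    have "p a * p b \<le> u a * u b"
      using u_upper[OF ad a] u_upper[OF ad b] seminorm_nonneg[OF p] nonneg a b by (intro mult_mono) auto
    with seminorm_mult[OF p a b] show "p (a * b) \<le> u a * u b" by simp
  qed
qed

lemma u_rel: "r \<in> R \<Longrightarrow> u r = 0"
  using u_upper[OF admissible_zero, of r] rels_free
  by (intro antisym u_least) (auto simp: admissible_def)

lemmas u_nonneg = seminorm_nonneg[OF u_seminorm]
  and u_cst = seminorm_cst[OF u_seminorm]
  and u_star = seminorm_star[OF u_seminorm]
  and u_add = seminorm_add[OF u_seminorm]
  and u_mult = seminorm_mult[OF u_seminorm]
  and u_0 = seminorm_0[OF u_seminorm]
  and u_uminus = seminorm_uminus[OF u_seminorm]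
  and u_minus = seminorm_minus[OF u_seminorm]
  and u_minus_commute = seminorm_minus_commute[OF u_seminorm]
  and u_diff_abs = seminorm_diff_abs[OF u_seminorm]
  and u_adj = seminorm_adj[OF u_seminorm]

end


lemma cauchy_ring_simps [simp]:
  "mult (cauchy_ring X R) s t = (\<lambda>n. s n * t n)"
  "one (cauchy_ring X R) = (\<lambda>n. 1)"
  "zero (cauchy_ring X R) = (\<lambda>n. 0)"
  "add (cauchy_ring X R) s t = (\<lambda>n. s n + t n)"
  by (simp_all add: cauchy_ring_def)

lemma ring_cong:
  fixes Q :: "'a ring" and R :: "('a, 'b) ring_scheme"
  assumes "ring Q" and eq: "carrier R = carrier Q" "mult R = mult Q" "one R = one Q"
    "add R = add Q" "zero R = zero Q"
  shows "ring R"
proof -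
  interpret Q: ring Q by fact
  have l: "\<exists>y\<in>carrier R. y \<oplus>\<^bsub>R\<^esub> x = \<zero>\<^bsub>R\<^esub>" if "x \<in> carrier R" for x
    using that Q.l_neg[of x] Q.a_inv_closed[of x] unfolding eq by blast
  show ?thesis
    by (intro ringI abelian_groupI monoidI l; (assumption | unfold eq))
      (auto simp: Q.a_assoc Q.m_assoc Q.l_distr Q.r_distr intro: Q.a_comm)
qed

context bounded_presentation
begin

abbreviation "S \<equiv> cauchy_ring X R"
abbreviation "N \<equiv> null_sequences X R"
abbreviation "U \<equiv> universal_cstar X R"
abbreviation "cls \<equiv> coset X R"

lemma S_iff: "s \<in> carrier S \<longleftrightarrow>
    (\<forall>n. s n \<in> F) \<and> (\<forall>\<epsilon>>0. \<exists>N. \<forall>m\<ge>N. \<forall>n\<ge>N. u (s m - s n) < \<epsilon>)"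
  by (auto simp: cauchy_ring_def)

lemma S_F: "s \<in> carrier S \<Longrightarrow> s n \<in> F"
  by (simp add: S_iff)

lemma S_Cauchy: "\<lbrakk>s \<in> carrier S; 0 < \<epsilon>\<rbrakk> \<Longrightarrow> \<exists>N. \<forall>m\<ge>N. \<forall>n\<ge>N. u (s m - s n) < \<epsilon>"
  by (simp add: S_iff)

lemma N_iff: "s \<in> N \<longleftrightarrow> (\<forall>n. s n \<in> F) \<and> (\<lambda>n. u (s n)) \<longlonglongrightarrow> 0"
  by (auto simp: null_sequences_def)

lemma S_const: "a \<in> F \<Longrightarrow> (\<lambda>n. a) \<in> carrier S"
  by (auto simp: S_iff u_0)

lemma S_add:
  assumes s: "s \<in> carrier S" and t: "t \<in> carrier S"
  shows "(\<lambda>n. s n + t n) \<in> carrier S"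
  unfolding S_iff
proof (intro conjI allI impI)
  fix \<epsilon> :: real assume "0 < \<epsilon>"
  then have "0 < \<epsilon> / 2" by simp
  from S_Cauchy[OF s this] S_Cauchy[OF t this] obtain M N where
    M: "\<forall>m\<ge>M. \<forall>n\<ge>M. u (s m - s n) < \<epsilon> / 2" and N: "\<forall>m\<ge>N. \<forall>n\<ge>N. u (t m - t n) < \<epsilon> / 2"
    by blast
  have "u (s m + t m - (s n + t n)) < \<epsilon>" if "m \<ge> max M N" "n \<ge> max M N" for m n
  proof -
    have eq: "s m + t m - (s n + t n) = (s m - s n) + (t m - t n)" by simp
    have "u (s m + t m - (s n + t n)) \<le> u (s m - s n) + u (t m - t n)"
      unfolding eq by (rule u_add) (simp_all add: S_F s t)
    with M N that show ?thesis by (smt (verit) field_sum_of_halves max.bounded_iff)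
  qed
  then show "\<exists>N. \<forall>m\<ge>N. \<forall>n\<ge>N. u (s m + t m - (s n + t n)) < \<epsilon>" by blast
qed (use S_F s t in simp)

lemma S_bounded:
  assumes s: "s \<in> carrier S"
  obtains M where "M > 0" "\<And>n. u (s n) \<le> M"
proof -
  from S_Cauchy[OF s, of 1] obtain N where N: "\<forall>m\<ge>N. \<forall>n\<ge>N. u (s m - s n) < 1" by auto
  define M where "M = (\<Sum>n<N. u (s n)) + u (s N) + 1"
  have nn: "0 \<le> u (s n)" for n using S_F[OF s] u_nonneg by simp
  have nns: "0 \<le> (\<Sum>n<N. u (s n))" using nn by (intro sum_nonneg)
  have "u (s n) \<le> M" for n
  proof (cases "n < N")
    case True
    then have "u (s n) \<le> (\<Sum>n<N. u (s n))" using nn by (intro member_le_sum) auto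
    then show ?thesis using nn[of N] by (simp add: M_def)
  next
    case False
    then have "u (s n - s N) < 1" using N by simp
    then have "u (s n) \<le> u (s N) + 1" using u_diff_abs[of "s n" "s N"] S_F[OF s] by simp
    then show ?thesis using nns by (simp add: M_def)
  qed
  moreover have "M > 0" using nns nn[of N] by (simp add: M_def)
  ultimately show thesis using that by blast
qed

lemma S_mult:
  assumes s: "s \<in> carrier S" and t: "t \<in> carrier S"
  shows "(\<lambda>n. s n * t n) \<in> carrier S"
  unfolding S_iff
proof (intro conjI allI impI)
  from S_bounded[OF s] obtain A where A: "A > 0" "\<And>n. u (s n) \<le> A" by blast
  from S_bounded[OF t] obtain B where B: "B > 0" "\<And>n. u (t n) \<le> B" by blast
  fix \<epsilon> :: real assume e: "0 < \<epsilon>"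
  have "0 < \<epsilon> / (2 * B)" "0 < \<epsilon> / (2 * A)" using e A B by simp_all
  from S_Cauchy[OF s this(1)] S_Cauchy[OF t this(2)] obtain M N where
    M: "\<forall>m\<ge>M. \<forall>n\<ge>M. u (s m - s n) < \<epsilon> / (2 * B)"
    and N: "\<forall>m\<ge>N. \<forall>n\<ge>N. u (t m - t n) < \<epsilon> / (2 * A)"
    by blast
  have "u (s m * t m - s n * t n) < \<epsilon>" if "m \<ge> max M N" "n \<ge> max M N" for m n
  proof -
    have eq: "s m * t m - s n * t n = (s m - s n) * t m + s n * (t m - t n)"
      by (simp add: algebra_simps)
    have "u (s m * t m - s n * t n) \<le> u ((s m - s n) * t m) + u (s n * (t m - t n))"
      unfolding eq by (rule u_add) (simp_all add: S_F s t)
    also have "\<dots> \<le> u (s m - s n) * u (t m) + u (s n) * u (t m - t n)"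
      using S_F s t by (intro add_mono u_mult) simp_all
    also have "\<dots> \<le> u (s m - s n) * B + A * u (t m - t n)"
      using S_F s t A B u_nonneg by (intro add_mono mult_mono) (simp_all add: less_imp_le)
    also have "\<dots> < \<epsilon> / (2 * B) * B + A * (\<epsilon> / (2 * A))"
      using M N that A B by (intro add_strict_mono mult_strict_left_mono mult_strict_right_mono) simp_all
    also have "\<dots> = \<epsilon>" using A B by simp
    finally show ?thesis .
  qed
  then show "\<exists>N. \<forall>m\<ge>N. \<forall>n\<ge>N. u (s m * t m - s n * t n) < \<epsilon>" by blast
qed (use S_F s t in simp)

lemma S_adj: "s \<in> carrier S \<Longrightarrow> (\<lambda>n. adj (s n)) \<in> carrier S"
  by (simp add: S_iff adj_minus[symmetric] u_adj)

lemma S_cst: "s \<in> carrier S \<Longrightarrow> (\<lambda>n. cst c * s n) \<in> carrier S"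
  by (rule S_mult[OF S_const]) simp_all

lemma S_uminus: "s \<in> carrier S \<Longrightarrow> (\<lambda>n. - s n) \<in> carrier S"
  using S_cst[of s "-1"] by (simp add: cst_minus_1)

lemma S_minus: "\<lbrakk>s \<in> carrier S; t \<in> carrier S\<rbrakk> \<Longrightarrow> (\<lambda>n. s n - t n) \<in> carrier S"
  using S_add[of s "\<lambda>n. - t n"] S_uminus by simp

lemma ring_S: "ring S"
proof -
  have l: "\<exists>y\<in>carrier S. y \<oplus>\<^bsub>S\<^esub> x = \<zero>\<^bsub>S\<^esub>" if "x \<in> carrier S" for x
    using S_uminus[OF that] by (intro bexI[of _ "\<lambda>n. - x n"]) simp_all
  show ?thesis
    by (intro ringI abelian_groupI monoidI l)
      (simp_all add: S_const S_add S_mult add_ac mult.assoc distrib_left distrib_right)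
qed

lemma S_lim:
  assumes s: "s \<in> carrier S"
  shows "\<exists>r. (\<lambda>n. u (s n)) \<longlonglongrightarrow> r"
proof -
  have "Cauchy (\<lambda>n. u (s n))"
    unfolding Cauchy_def dist_real_def
    using S_Cauchy[OF s] u_diff_abs S_F[OF s] by (meson le_less_trans)
  then show ?thesis by (simp add: Cauchy_convergent_iff convergent_def)
qed

lemma N_S: "s \<in> N \<Longrightarrow> s \<in> carrier S"
  unfolding S_iff
proof (intro conjI allI impI)
  assume s: "s \<in> N"
  then show "s n \<in> F" for n by (simp add: N_iff)
  fix \<epsilon> :: real assume "0 < \<epsilon>"
  then have "0 < \<epsilon> / 2" by simp
  moreover from s have "(\<lambda>n. u (s n)) \<longlonglongrightarrow> 0" by (simp add: N_iff)
  ultimately have "\<forall>\<^sub>F n in sequentially. u (s n) < \<epsilon> / 2" by (rule order_tendstoD(2)[rotated])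
  then obtain N where N: "\<forall>n\<ge>N. u (s n) < \<epsilon> / 2" by (auto simp: eventually_sequentially)
  have "u (s m - s n) < \<epsilon>" if "m \<ge> N" "n \<ge> N" for m n
    using u_minus[of "s m" "s n"] s N that by (smt (verit) N_iff field_sum_of_halves)
  then show "\<exists>N. \<forall>m\<ge>N. \<forall>n\<ge>N. u (s m - s n) < \<epsilon>" by blast
qed

lemma N_squeeze:
  assumes "\<And>n. s n \<in> F" "f \<longlonglongrightarrow> 0" "\<And>n. u (s n) \<le> f n"
  shows "s \<in> N"
proof -
  have "(\<lambda>n. u (s n)) \<longlonglongrightarrow> 0"
    by (rule tendsto_sandwich[OF _ _ tendsto_const assms(2)]) (simp_all add: assms u_nonneg)
  with assms(1) show ?thesis by (simp add: N_iff)
qed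

lemma N_add: "\<lbrakk>s \<in> N; t \<in> N\<rbrakk> \<Longrightarrow> (\<lambda>n. s n + t n) \<in> N"
  by (rule N_squeeze[of _ "\<lambda>n. u (s n) + u (t n)"]) (auto simp: N_iff u_add intro: tendsto_add_zero)

lemma N_mult_left:
  assumes s: "s \<in> carrier S" and t: "t \<in> N"
  shows "(\<lambda>n. s n * t n) \<in> N"
proof -
  from S_bounded[OF s] obtain A where A: "A > 0" "\<And>n. u (s n) \<le> A" by blast
  have F: "s n \<in> F" "t n \<in> F" for n using s t by (simp_all add: S_F N_iff)
  have "u (s n * t n) \<le> A * u (t n)" for n
    using u_mult[OF F] A(2)[of n] u_nonneg[OF F(2)] by (meson mult_right_mono order_trans)
  moreover have "(\<lambda>n. A * u (t n)) \<longlonglongrightarrow> 0" using t by (simp add: N_iff tendsto_mult_right_zero)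
  ultimately show ?thesis using F by (intro N_squeeze) auto
qed

lemma N_adj: "s \<in> N \<Longrightarrow> (\<lambda>n. adj (s n)) \<in> N"
  by (simp add: N_iff u_adj)

lemma N_mult_right:
  assumes s: "s \<in> carrier S" and t: "t \<in> N"
  shows "(\<lambda>n. t n * s n) \<in> N"
  using N_adj[OF N_mult_left[OF S_adj[OF s] N_adj[OF t]]] by (simp add: adj_mult)

lemma N_cst: "s \<in> N \<Longrightarrow> (\<lambda>n. cst c * s n) \<in> N"
  by (rule N_mult_left[OF S_const]) simp_all

lemma N_uminus: "s \<in> N \<Longrightarrow> (\<lambda>n. - s n) \<in> N"
  using N_cst[of s "-1"] by (simp add: cst_minus_1)

lemma N_minus: "\<lbrakk>s \<in> N; t \<in> N\<rbrakk> \<Longrightarrow> (\<lambda>n. s n - t n) \<in> N"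
  using N_add[of s "\<lambda>n. - t n"] N_uminus by simp

lemma N_0: "(\<lambda>n. 0) \<in> N"
  by (simp add: N_iff u_0)

lemma a_inv_S: "s \<in> carrier S \<Longrightarrow> \<ominus>\<^bsub>S\<^esub> s = (\<lambda>n. - s n)"
  using S_uminus by (intro abelian_group.minus_equality ring.is_abelian_group ring_S) simp_all

lemma ideal_N: "ideal N S"
proof (rule idealI[OF ring_S])
  show "subgroup N (add_monoid S)"
  proof (unfold_locales)
    show "N \<subseteq> carrier (add_monoid S)" using N_S by auto
    show "inv\<^bsub>add_monoid S\<^esub> x \<in> N" if "x \<in> N" for x
      using N_uminus[OF that] a_inv_S[OF N_S[OF that]] by (simp add: a_inv_def)
  qed (simp_all add: N_add N_0)
qed (simp_all add: N_mult_left N_mult_right)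

sublocale I: ideal N S by (rule ideal_N)

lemma mem_cls: "s \<in> carrier S \<Longrightarrow> t \<in> cls s \<longleftrightarrow> (\<forall>n. t n \<in> F) \<and> (\<lambda>n. t n - s n) \<in> N"
proof -
  assume s: "s \<in> carrier S"
  have "t \<in> cls s \<longleftrightarrow> (\<exists>z\<in>N. t = (\<lambda>n. z n + s n))"
    by (auto simp: coset_def a_r_coset_def r_coset_def)
  also have "\<dots> \<longleftrightarrow> (\<forall>n. t n \<in> F) \<and> (\<lambda>n. t n - s n) \<in> N"
  proof safe
    fix z n assume "z \<in> N" then show "z n + s n \<in> F" using S_F[OF s] by (simp add: N_iff)
  next
    assume "(\<lambda>n. t n - s n) \<in> N"
    then show "\<exists>z\<in>N. t = (\<lambda>n. z n + s n)" by (rule bexI[rotated]) simp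
  qed simp
  finally show ?thesis .
qed

lemma cls_S: "\<lbrakk>s \<in> carrier S; t \<in> cls s\<rbrakk> \<Longrightarrow> t \<in> carrier S"
  using S_add[OF N_S, of "\<lambda>n. t n - s n" s] by (simp add: mem_cls)

lemma cls_self: "s \<in> carrier S \<Longrightarrow> s \<in> cls s"
  by (simp add: mem_cls S_F N_0)

lemma cls_eq: "\<lbrakk>s \<in> carrier S; t \<in> carrier S\<rbrakk> \<Longrightarrow> cls s = cls t \<longleftrightarrow> (\<lambda>n. s n - t n) \<in> N"
proof
  assume s: "s \<in> carrier S" and t: "t \<in> carrier S"
  show "(\<lambda>n. s n - t n) \<in> N" if "cls s = cls t"
    using cls_self[OF s] that t by (simp add: mem_cls)
  assume st: "(\<lambda>n. s n - t n) \<in> N"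
  have "(\<lambda>n. r n - s n) \<in> N \<longleftrightarrow> (\<lambda>n. r n - t n) \<in> N" for r
    using N_add[OF st, of "\<lambda>n. r n - s n"] N_minus[OF _ st, of "\<lambda>n. r n - t n"] by auto
  then show "cls s = cls t" using s t by (auto simp: mem_cls)
qed

lemma U_carrier: "carrier U = cls ` carrier S"
proof -
  have "carrier U = a_rcosets\<^bsub>S\<^esub> N" by (simp add: universal_cstar_def Let_def FactRing_def)
  then show ?thesis by (auto simp: A_RCOSETS_def' coset_def)
qed

lemma U_cls: "s \<in> carrier S \<Longrightarrow> cls s \<in> carrier U"
  by (simp add: U_carrier)

lemma U_add: "\<lbrakk>s \<in> carrier S; t \<in> carrier S\<rbrakk> \<Longrightarrow> cls s \<oplus>\<^bsub>U\<^esub> cls t = cls (\<lambda>n. s n + t n)"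
  by (simp add: universal_cstar_def Let_def FactRing_def coset_def I.a_rcos_sum)

lemma U_mult: "\<lbrakk>s \<in> carrier S; t \<in> carrier S\<rbrakk> \<Longrightarrow> cls s \<otimes>\<^bsub>U\<^esub> cls t = cls (\<lambda>n. s n * t n)"
  by (simp add: universal_cstar_def Let_def FactRing_def coset_def I.rcoset_mult_add)

lemma U_one: "\<one>\<^bsub>U\<^esub> = cls (\<lambda>n. 1)"
  by (simp add: universal_cstar_def Let_def FactRing_def coset_def)

lemma U_zero: "\<zero>\<^bsub>U\<^esub> = cls (\<lambda>n. 0)"
proof -
  have "\<zero>\<^bsub>U\<^esub> = N" by (simp add: universal_cstar_def Let_def FactRing_def)
  also have "N = cls (\<lambda>n. 0)" using S_const[of 0] by (auto simp: mem_cls N_iff)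
  finally show ?thesis .
qed

lemma U_smult: "s \<in> carrier S \<Longrightarrow> c \<odot>\<^bsub>U\<^esub> cls s = cls (\<lambda>n. cst c * s n)"
proof -
  assume s: "s \<in> carrier S"
  have eq: "cls (\<lambda>n. cst c * t n) = cls (\<lambda>n. cst c * s n)" if "t \<in> cls s" for t
    using cls_S[OF s that] s N_cst[of "\<lambda>n. t n - s n" c] that
    by (simp add: cls_eq S_cst mem_cls right_diff_distrib)
  have "(\<Union>t\<in>cls s. cls (\<lambda>n. cst c * t n)) = cls (\<lambda>n. cst c * s n)"
    by (intro UN_constant_eq[OF cls_self[OF s]] ballI eq)
  moreover have "c \<odot>\<^bsub>U\<^esub> cls s = (\<Union>t\<in>cls s. cls (\<lambda>n. cst c * t n))"
    by (simp add: universal_cstar_def Let_def)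
  ultimately show ?thesis by simp
qed

lemma U_star: "s \<in> carrier S \<Longrightarrow> star U (cls s) = cls (\<lambda>n. adj (s n))"
proof -
  assume s: "s \<in> carrier S"
  have eq: "cls (\<lambda>n. adj (t n)) = cls (\<lambda>n. adj (s n))" if "t \<in> cls s" for t
    using cls_S[OF s that] s N_adj[of "\<lambda>n. t n - s n"] that
    by (simp add: cls_eq S_adj mem_cls adj_minus)
  have "(\<Union>t\<in>cls s. cls (\<lambda>n. adj (t n))) = cls (\<lambda>n. adj (s n))"
    by (intro UN_constant_eq[OF cls_self[OF s]] ballI eq)
  moreover have "star U (cls s) = (\<Union>t\<in>cls s. cls (\<lambda>n. adj (t n)))"
    by (simp add: universal_cstar_def Let_def)
  ultimately show ?thesis by simp
qed

lemma U_nrm: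
  assumes s: "s \<in> carrier S"
  shows "(\<lambda>n. u (s n)) \<longlonglongrightarrow> nrm U (cls s)"
proof -
  from S_lim[OF s] obtain r where r: "(\<lambda>n. u (s n)) \<longlonglongrightarrow> r" ..
  have "(\<lambda>n. u (t n)) \<longlonglongrightarrow> r" if t: "t \<in> cls s" for t
  proof -
    have tF: "t n \<in> F" for n using t s by (simp add: mem_cls)
    have "(\<lambda>n. u (t n - s n)) \<longlonglongrightarrow> 0" using t s by (simp add: mem_cls N_iff)
    then have "(\<lambda>n. u (t n) - u (s n)) \<longlonglongrightarrow> 0"
      
      by (rule tendsto_0_le[where K = 1]) (simp add: u_diff_abs u_nonneg tF S_F[OF s])
    from tendsto_add[OF this r] show ?thesis by simp
  qed
  then have "(THE r. \<forall>t\<in>cls s. (\<lambda>n. u (t n)) \<longlonglongrightarrow> r) = r"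
    using cls_self[OF s] by (intro the_equality) (blast intro: LIMSEQ_unique[OF _ r])+
  with r show ?thesis by (simp add: universal_cstar_def Let_def)
qed

lemma U_ring: "ring U"
proof -
  have "ring (S Quot N)" by (rule I.quotient_is_ring)
  then show ?thesis
    by (rule ring_cong) (simp_all add: universal_cstar_def Let_def)
qed

end


lemma cring_complex_field: "cring complex_field"
proof (rule cringI)
  show "abelian_group complex_field"
    by (rule abelian_groupI)
      (auto simp: complex_field_def add_ac intro: exI[of _ "- x" for x])
  show "comm_monoid complex_field"
    by (rule comm_monoidI) (simp_all add: complex_field_def mult_ac)
qed (simp add: complex_field_def distrib_right)

lemma complex_field_simps [simp]:
  "c \<in> carrier complex_field"
  "\<one>\<^bsub>complex_field\<^esub> = 1" "\<zero>\<^bsub>complex_field\<^esub> = 0"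
  "c \<oplus>\<^bsub>complex_field\<^esub> d = c + d" "c \<otimes>\<^bsub>complex_field\<^esub> d = c * d"
  by (simp_all add: complex_field_def)

context bounded_presentation
begin

lemma U_cases: "x \<in> carrier U \<Longrightarrow> (\<And>s. \<lbrakk>s \<in> carrier S; x = cls s\<rbrakk> \<Longrightarrow> thesis) \<Longrightarrow> thesis"
  by (auto simp: U_carrier)

lemma U_minus: "\<lbrakk>s \<in> carrier S; t \<in> carrier S\<rbrakk> \<Longrightarrow> cls s \<ominus>\<^bsub>U\<^esub> cls t = cls (\<lambda>n. s n - t n)"
proof -
  assume s: "s \<in> carrier S" and t: "t \<in> carrier S"
  interpret ring U by (rule U_ring)
  have "\<ominus>\<^bsub>U\<^esub> cls t = cls (\<lambda>n. - t n)"
    using t by (intro minus_equality) (simp_all add: U_cls U_add U_zero S_uminus)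
  then show ?thesis using s t by (simp add: a_minus_def U_add S_uminus)
qed

lemma U_nrm_const: "a \<in> F \<Longrightarrow> nrm U (cls (\<lambda>n. a)) = u a"
  using U_nrm[OF S_const] by (simp add: LIMSEQ_const_iff)

lemma U_module: "module complex_field U"
proof (rule moduleI[OF cring_complex_field ring.is_abelian_group[OF U_ring]])
qed (auto elim!: U_cases simp: U_smult U_cls U_add S_add S_cst cst_add cst_mult
    distrib_right distrib_left mult.assoc)

lemma U_complete:
  assumes z: "\<And>k. z k \<in> carrier U"
    and Cauchy: "\<And>\<epsilon>. 0 < \<epsilon> \<Longrightarrow> \<exists>N. \<forall>m\<ge>N. \<forall>n\<ge>N. nrm U (z m \<ominus>\<^bsub>U\<^esub> z n) < \<epsilon>"
  shows "\<exists>x\<in>carrier U. (\<lambda>n. nrm U (z n \<ominus>\<^bsub>U\<^esub> x)) \<longlonglongrightarrow> 0"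
proof -
  have "\<exists>s. s \<in> carrier S \<and> z k = cls s" for k
    using z[of k] by (auto simp: U_carrier)
  then obtain s where s: "\<And>k. s k \<in> carrier S" "\<And>k. z k = cls (s k)" by metis
  have "\<exists>a\<in>F. \<exists>K. \<forall>n\<ge>K. u (s k n - a) < inverse (Suc k)" for k
  proof -
    have "0 < inverse (real (Suc k))" by simp
    from S_Cauchy[OF s(1) this] obtain K where
      "\<forall>m\<ge>K. \<forall>n\<ge>K. u (s k m - s k n) < inverse (Suc k)" by blast
    then show ?thesis using S_F[OF s(1)] by (intro bexI[of _ "s k K"]) auto
  qed
  then obtain a where a: "\<And>k. a k \<in> F"
    and sa: "\<And>k. \<exists>K. \<forall>n\<ge>K. u (s k n - a k) < inverse (Suc k)" by metis
  have inv: "\<exists>M. \<forall>m\<ge>M. inverse (real (Suc m)) < \<epsilon>" if "0 < \<epsilon>" for \<epsilon>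
    using order_tendstoD(2)[OF LIMSEQ_inverse_real_of_nat that] by (simp add: eventually_sequentially)
  have aS: "a \<in> carrier S"
    unfolding S_iff
  proof (intro conjI allI impI a)
    fix \<epsilon> :: real assume "0 < \<epsilon>"
    then have e: "0 < \<epsilon> / 3" by simp
    from Cauchy[OF e] obtain L where L: "\<forall>m\<ge>L. \<forall>n\<ge>L. nrm U (z m \<ominus>\<^bsub>U\<^esub> z n) < \<epsilon> / 3" ..
    from inv[OF e] obtain M where M: "\<forall>m\<ge>M. inverse (real (Suc m)) < \<epsilon> / 3" ..
    have "u (a m - a n) < \<epsilon>" if mn: "m \<ge> max L M" "n \<ge> max L M" for m n
    proof -
      have "(\<lambda>k. u (s m k - s n k)) \<longlonglongrightarrow> nrm U (z m \<ominus>\<^bsub>U\<^esub> z n)"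
        using U_nrm[OF S_minus[OF s(1) s(1)]] by (simp add: s U_minus)
      moreover have "nrm U (z m \<ominus>\<^bsub>U\<^esub> z n) < \<epsilon> / 3" using L mn by simp
      ultimately have "\<forall>\<^sub>F k in sequentially. u (s m k - s n k) < \<epsilon> / 3"
        by (rule order_tendstoD(2))
      then obtain K0 where K0: "\<forall>k\<ge>K0. u (s m k - s n k) < \<epsilon> / 3"
        by (auto simp: eventually_sequentially)
      from sa[of m] obtain K1 where K1: "\<forall>k\<ge>K1. u (s m k - a m) < inverse (Suc m)" ..
      from sa[of n] obtain K2 where K2: "\<forall>k\<ge>K2. u (s n k - a n) < inverse (Suc n)" ..
      define k where "k = max K0 (max K1 K2)"
      have F: "s m k \<in> F" "s n k \<in> F" by (rule S_F[OF s(1)])+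
      have eq: "a m - a n = (a m - s m k) + ((s m k - s n k) + (s n k - a n))" by simp
      have "u (a m - a n) \<le> u (a m - s m k) + u ((s m k - s n k) + (s n k - a n))"
        unfolding eq by (rule u_add) (simp_all add: F a)
      also have "\<dots> \<le> u (s m k - a m) + (u (s m k - s n k) + u (s n k - a n))"
        by (intro add_mono u_add) (simp_all add: F a u_minus_commute)
      also have "\<dots> < \<epsilon> / 3 + (\<epsilon> / 3 + \<epsilon> / 3)"
        using K0 less_trans[OF K1[rule_format, of k] M[rule_format, of m]]
          less_trans[OF K2[rule_format, of k] M[rule_format, of n]] mn
        by (intro add_strict_mono) (simp_all add: k_def)
      also have "\<dots> = \<epsilon>" by simp
      finally show ?thesis .
    qed
    then show "\<exists>N. \<forall>m\<ge>N. \<forall>n\<ge>N. u (a m - a n) < \<epsilon>" by blast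
  qed
  have "\<exists>M. \<forall>m\<ge>M. norm (nrm U (z m \<ominus>\<^bsub>U\<^esub> cls a) - 0) < \<epsilon>" if "0 < \<epsilon>" for \<epsilon>
  proof -
    from that have e: "0 < \<epsilon> / 3" by simp
    from inv[OF e] obtain M where M: "\<forall>m\<ge>M. inverse (real (Suc m)) < \<epsilon> / 3" ..
    from S_Cauchy[OF aS e] obtain L where L: "\<forall>m\<ge>L. \<forall>n\<ge>L. u (a m - a n) < \<epsilon> / 3" ..
    have "norm (nrm U (z m \<ominus>\<^bsub>U\<^esub> cls a) - 0) < \<epsilon>" if mn: "m \<ge> max L M" for m
    proof -
      have lim: "(\<lambda>k. u (s m k - a k)) \<longlonglongrightarrow> nrm U (z m \<ominus>\<^bsub>U\<^esub> cls a)"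
        using U_nrm[OF S_minus[OF s(1) aS]] by (simp add: s U_minus aS)
      from sa[of m] obtain K1 where K1: "\<forall>k\<ge>K1. u (s m k - a m) < inverse (Suc m)" ..
      have "u (s m k - a k) \<le> \<epsilon> / 3 + \<epsilon> / 3" if k: "k \<ge> max K1 L" for k
      proof -
        have F: "s m k \<in> F" by (rule S_F[OF s(1)])
        have eq: "s m k - a k = (s m k - a m) + (a m - a k)" by simp
        have "u (s m k - a k) \<le> u (s m k - a m) + u (a m - a k)"
          unfolding eq by (rule u_add) (simp_all add: F a)
        also have "\<dots> \<le> \<epsilon> / 3 + \<epsilon> / 3"
          using less_trans[OF K1[rule_format, of k] M[rule_format, of m]] L mn k
          by (intro add_mono) (simp_all add: less_imp_le)
        finally show ?thesis .
      qed
      then have "nrm U (z m \<ominus>\<^bsub>U\<^esub> cls a) \<le> \<epsilon> / 3 + \<epsilon> / 3"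
        by (intro LIMSEQ_le_const2[OF lim]) blast
      moreover have "0 \<le> nrm U (z m \<ominus>\<^bsub>U\<^esub> cls a)"
        using S_F[OF s(1)] a by (intro LIMSEQ_le_const[OF lim]) (auto intro!: u_nonneg)
      ultimately show ?thesis using e by simp
    qed
    then show ?thesis by blast
  qed
  then have "(\<lambda>n. nrm U (z n \<ominus>\<^bsub>U\<^esub> cls a)) \<longlonglongrightarrow> 0"
    by (intro LIMSEQ_I)
  with U_cls[OF aS] show ?thesis by blast
qed

theorem cstar_algebra_universal: "cstar_algebra U"
proof (intro cstar_algebra.intro cstar_algebra_axioms.intro U_ring U_module)
  fix x assume "x \<in> carrier U"
  then obtain s where s: "s \<in> carrier S" and x: "x = cls s" by (rule U_cases)
  note lim_s = U_nrm[OF s]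
  show "star U x \<in> carrier U" "star U (star U x) = x"
    by (simp_all add: x U_star U_cls S_adj s)
  show "star U (c \<odot>\<^bsub>U\<^esub> x) = cnj c \<odot>\<^bsub>U\<^esub> star U x" for c
    by (simp add: x U_star U_smult S_adj S_cst s adj_mult cst_central)
  show "0 \<le> nrm U x"
    unfolding x using S_F[OF s] by (intro LIMSEQ_le_const[OF lim_s]) (auto intro!: u_nonneg)
  show "nrm U x = 0 \<longleftrightarrow> x = \<zero>\<^bsub>U\<^esub>"
  proof -
    have "nrm U x = 0 \<longleftrightarrow> (\<lambda>n. u (s n)) \<longlonglongrightarrow> 0"
      using lim_s LIMSEQ_unique[OF lim_s, of 0] unfolding x by auto
    also have "\<dots> \<longleftrightarrow> s \<in> N" using S_F[OF s] by (simp add: N_iff)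
    also have "\<dots> \<longleftrightarrow> x = \<zero>\<^bsub>U\<^esub>" using s by (simp add: x U_zero cls_eq S_const)
    finally show ?thesis .
  qed
  show "nrm U (c \<odot>\<^bsub>U\<^esub> x) = cmod c * nrm U x" for c
  proof (rule LIMSEQ_unique)
    show "(\<lambda>n. u (cst c * s n)) \<longlonglongrightarrow> nrm U (c \<odot>\<^bsub>U\<^esub> x)"
      using U_nrm[OF S_cst[OF s]] s by (simp add: x U_smult)
    show "(\<lambda>n. u (cst c * s n)) \<longlonglongrightarrow> cmod c * nrm U x"
      using tendsto_mult_left[OF lim_s] S_F[OF s] by (simp add: x u_cst)
  qed
  show "nrm U (star U x \<otimes>\<^bsub>U\<^esub> x) = (nrm U x)\<^sup>2"
  proof (rule LIMSEQ_unique)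
    show "(\<lambda>n. u (adj (s n) * s n)) \<longlonglongrightarrow> nrm U (star U x \<otimes>\<^bsub>U\<^esub> x)"
      using U_nrm[OF S_mult[OF S_adj[OF s] s]] s by (simp add: x U_star U_mult S_adj)
    show "(\<lambda>n. u (adj (s n) * s n)) \<longlonglongrightarrow> (nrm U x)\<^sup>2"
      using tendsto_power[OF lim_s, of 2] S_F[OF s] by (simp add: x u_star)
  qed
  fix y assume "y \<in> carrier U"
  then obtain t where t: "t \<in> carrier S" and y: "y = cls t" by (rule U_cases)
  note lim_t = U_nrm[OF t]
  show "(c \<odot>\<^bsub>U\<^esub> x) \<otimes>\<^bsub>U\<^esub> y = c \<odot>\<^bsub>U\<^esub> (x \<otimes>\<^bsub>U\<^esub> y)" for c
    by (simp add: x y U_smult U_mult S_cst S_mult s t mult.assoc)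
  show "x \<otimes>\<^bsub>U\<^esub> (c \<odot>\<^bsub>U\<^esub> y) = c \<odot>\<^bsub>U\<^esub> (x \<otimes>\<^bsub>U\<^esub> y)" for c
    by (simp add: x y U_smult U_mult S_cst S_mult s t mult.assoc[symmetric] cst_central)
  show "star U (x \<oplus>\<^bsub>U\<^esub> y) = star U x \<oplus>\<^bsub>U\<^esub> star U y"
    by (simp add: x y U_add U_star S_add S_adj s t adj_add)
  show "star U (x \<otimes>\<^bsub>U\<^esub> y) = star U y \<otimes>\<^bsub>U\<^esub> star U x"
    by (simp add: x y U_mult U_star S_mult S_adj s t adj_mult)
  show "nrm U (x \<oplus>\<^bsub>U\<^esub> y) \<le> nrm U x + nrm U y"
  proof (rule LIMSEQ_le)
    show "(\<lambda>n. u (s n + t n)) \<longlonglongrightarrow> nrm U (x \<oplus>\<^bsub>U\<^esub> y)"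
      using U_nrm[OF S_add[OF s t]] s t by (simp add: x y U_add)
    show "(\<lambda>n. u (s n) + u (t n)) \<longlonglongrightarrow> nrm U x + nrm U y"
      using tendsto_add[OF lim_s lim_t] by (simp add: x y)
  qed (use S_F[OF s] S_F[OF t] u_add in blast)
  show "nrm U (x \<otimes>\<^bsub>U\<^esub> y) \<le> nrm U x * nrm U y"
  proof (rule LIMSEQ_le)
    show "(\<lambda>n. u (s n * t n)) \<longlonglongrightarrow> nrm U (x \<otimes>\<^bsub>U\<^esub> y)"
      using U_nrm[OF S_mult[OF s t]] s t by (simp add: x y U_mult)
    show "(\<lambda>n. u (s n) * u (t n)) \<longlonglongrightarrow> nrm U x * nrm U y"
      using tendsto_mult[OF lim_s lim_t] by (simp add: x y)
  qed (use S_F[OF s] S_F[OF t] u_mult in blast)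
qed (rule U_complete)

end


lemma free_add_induct [consumes 1, case_names zero add]:
  assumes "f \<in> free_star_algebra X" and zero: "P 0"
    and add: "\<And>w c f. \<lbrakk>base ` set (letters w) \<subseteq> X; f \<in> free_star_algebra X; P f\<rbrakk> \<Longrightarrow>
      P (Poly_Mapping.single w c + f)"
  shows "P f"
  using assms(1)
proof (induction f rule: free_star_add_induct)
  case (add w c f)
  have "Poly_Mapping.keys (Poly_Mapping.single w c + f) = insert w (Poly_Mapping.keys f)"
    using add by (auto simp: in_keys_iff lookup_add lookup_single when_def split: if_splits)
  with add.prems have "base ` set (letters w) \<subseteq> X" "f \<in> free_star_algebra X"
    by (auto simp: free_star_algebra_def)
  with add.IH assms(3) show ?case by blast
qed (rule zero)

lemma free_single: "base ` set (letters w) \<subseteq> X \<Longrightarrow> Poly_Mapping.single w c \<in> free_star_algebra X"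
  by (simp add: free_star_algebra_def)

primrec letter_eval :: "'a star_algebra \<Rightarrow> ('x \<Rightarrow> 'a) \<Rightarrow> 'x letter \<Rightarrow> 'a"
  where "letter_eval B h (Gen x) = h x" | "letter_eval B h (Adj x) = star B (h x)"

definition word_eval :: "'a star_algebra \<Rightarrow> ('x \<Rightarrow> 'a) \<Rightarrow> 'x word \<Rightarrow> 'a"
  where "word_eval B h w = foldr (\<lambda>l y. letter_eval B h l \<otimes>\<^bsub>B\<^esub> y) (letters w) \<one>\<^bsub>B\<^esub>"

definition star_eval :: "'a star_algebra \<Rightarrow> ('x \<Rightarrow> 'a) \<Rightarrow> 'x free_star \<Rightarrow> 'a"
  where "star_eval B h f =
    (\<Oplus>\<^bsub>B\<^esub>w\<in>Poly_Mapping.keys f. Poly_Mapping.lookup f w \<odot>\<^bsub>B\<^esub> word_eval B h w)"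

context cstar_algebra
begin

lemma smult_closed [simp]: "x \<in> carrier A \<Longrightarrow> c \<odot> x \<in> carrier A"
  by (rule scal.smult_closed) simp_all

lemma smult_add_left: "x \<in> carrier A \<Longrightarrow> (c + d) \<odot> x = c \<odot> x \<oplus> d \<odot> x"
  using scal.smult_l_distr[of c d x] by simp

lemma smult_add_right: "\<lbrakk>x \<in> carrier A; y \<in> carrier A\<rbrakk> \<Longrightarrow> c \<odot> (x \<oplus> y) = c \<odot> x \<oplus> c \<odot> y"
  using scal.smult_r_distr[of c x y] by simp

lemma smult_assoc: "x \<in> carrier A \<Longrightarrow> (c * d) \<odot> x = c \<odot> (d \<odot> x)"
  using scal.smult_assoc1[of c d x] by simp

lemma smult_1 [simp]: "x \<in> carrier A \<Longrightarrow> 1 \<odot> x = x"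
  using scal.smult_one[of x] by simp

lemma smult_0 [simp]: "x \<in> carrier A \<Longrightarrow> 0 \<odot> x = \<zero>"
  using scal.smult_l_null[of x] by simp

lemma smult_zero [simp]: "c \<odot> \<zero> = \<zero>"
  using scal.smult_r_null[of c] by simp

declare star_closed [simp] star_star [simp]

lemma star_one [simp]: "star A \<one> = \<one>"
  by (metis l_one one_closed r_one star_closed star_mult star_star)

lemma star_zero [simp]: "star A \<zero> = \<zero>"
  using star_smult[of \<zero> 0] by simp

lemma minus_smult: "x \<in> carrier A \<Longrightarrow> \<ominus> x = (-1) \<odot> x"
proof (rule minus_equality)
  assume x: "x \<in> carrier A"
  show "(-1) \<odot> x \<oplus> x = \<zero>" using smult_add_left[OF x, of "-1" 1] x by simp
qed simp_all

lemma nrm_minus: "x \<in> carrier A \<Longrightarrow> nrm A (\<ominus> x) = nrm A x"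
  by (simp add: minus_smult nrm_smult)

lemma nrm_zero [simp]: "nrm A \<zero> = 0"
  by (simp add: nrm_eq_0_iff)

lemma nrm_star_le: "x \<in> carrier A \<Longrightarrow> nrm A x \<le> nrm A (star A x)"
proof -
  assume x: "x \<in> carrier A"
  have "nrm A x * nrm A x \<le> nrm A (star A x) * nrm A x"
    using nrm_star_mult[OF x] nrm_mult[of "star A x" x] x by (simp add: power2_eq_square)
  then show ?thesis
    using nrm_nonneg[OF x] nrm_nonneg[OF star_closed[OF x]] by (cases "nrm A x = 0") auto
qed

lemma nrm_star: "x \<in> carrier A \<Longrightarrow> nrm A (star A x) = nrm A x"
  using nrm_star_le[of x] nrm_star_le[of "star A x"] by simp

lemma nrm_diff_triangle:
  "\<lbrakk>x \<in> carrier A; y \<in> carrier A; z \<in> carrier A\<rbrakk> \<Longrightarrow> nrm A (x \<ominus> z) \<le> nrm A (x \<ominus> y) + nrm A (y \<ominus> z)"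
proof -
  assume *: "x \<in> carrier A" "y \<in> carrier A" "z \<in> carrier A"
  then have "x \<ominus> z = (x \<ominus> y) \<oplus> (y \<ominus> z)" by algebra
  with * show ?thesis using nrm_triangle[of "x \<ominus> y" "y \<ominus> z"] by simp
qed

lemma nrm_diff_commute: "\<lbrakk>x \<in> carrier A; y \<in> carrier A\<rbrakk> \<Longrightarrow> nrm A (x \<ominus> y) = nrm A (y \<ominus> x)"
proof -
  assume *: "x \<in> carrier A" "y \<in> carrier A"
  then have "x \<ominus> y = \<ominus> (y \<ominus> x)" by algebra
  with * show ?thesis using nrm_minus[of "y \<ominus> x"] by simp
qed

lemma diff_eq_zero: "\<lbrakk>x \<in> carrier A; y \<in> carrier A; x \<ominus> y = \<zero>\<rbrakk> \<Longrightarrow> x = y"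
proof -
  assume *: "x \<in> carrier A" "y \<in> carrier A" "x \<ominus> y = \<zero>"
  from *(1,2) have "x = (x \<ominus> y) \<oplus> y" by algebra
  with * show ?thesis by simp
qed

end


locale star_evaluation = cstar_algebra A for A :: "'a star_algebra" (structure) +
  fixes X :: "'x set" and h :: "'x \<Rightarrow> 'a"
  assumes h_closed: "x \<in> X \<Longrightarrow> h x \<in> carrier A"
begin

abbreviation "ev \<equiv> star_eval A h"
abbreviation "wev \<equiv> word_eval A h"
abbreviation "WX \<equiv> {w. base ` set (letters w) \<subseteq> X}"

lemma letter_closed: "base l \<in> X \<Longrightarrow> letter_eval A h l \<in> carrier A"
  by (cases l) (simp_all add: h_closed)

lemma foldr_closed: "\<lbrakk>base ` set ls \<subseteq> X; z \<in> carrier A\<rbrakk> \<Longrightarrow>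
    foldr (\<lambda>l y. letter_eval A h l \<otimes> y) ls z \<in> carrier A"
  by (induction ls) (simp_all add: letter_closed)

lemma word_closed: "w \<in> WX \<Longrightarrow> wev w \<in> carrier A"
  by (simp add: word_eval_def foldr_closed)

lemma foldr_mult: "\<lbrakk>base ` set ls \<subseteq> X; z \<in> carrier A\<rbrakk> \<Longrightarrow>
    foldr (\<lambda>l y. letter_eval A h l \<otimes> y) ls z = foldr (\<lambda>l y. letter_eval A h l \<otimes> y) ls \<one> \<otimes> z"
  by (induction ls) (simp_all add: letter_closed foldr_closed m_assoc)

lemma word_add: "\<lbrakk>v \<in> WX; w \<in> WX\<rbrakk> \<Longrightarrow> wev (v + w) = wev v \<otimes> wev w"
  using foldr_mult[of "letters v" "wev w"] word_closed[of w]
  by (simp add: word_eval_def plus_word_def)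

lemma letter_flip: "base l \<in> X \<Longrightarrow> letter_eval A h (flip l) = star A (letter_eval A h l)"
  by (cases l) (simp_all add: h_closed)

lemma word_adj:
  assumes w: "w \<in> WX"
  shows "wev (word_adj w) = star A (wev w)"
proof -
  have "foldr (\<lambda>l y. letter_eval A h l \<otimes> y) (rev (map flip ls)) \<one> =
      star A (foldr (\<lambda>l y. letter_eval A h l \<otimes> y) ls \<one>)" if "base ` set ls \<subseteq> X" for ls
    using that
  proof (induction ls)
    case (Cons l ls)
    have sub: "base ` set (rev (map flip ls)) \<subseteq> X" using Cons.prems by (simp add: image_image)
    have lsub: "base ` set ls \<subseteq> X" and lc: "letter_eval A h l \<in> carrier A"
      using Cons.prems by (simp_all add: letter_closed)
    have "foldr (\<lambda>l y. letter_eval A h l \<otimes> y) (rev (map flip (l # ls))) \<one> =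
        foldr (\<lambda>l y. letter_eval A h l \<otimes> y) (rev (map flip ls)) (star A (letter_eval A h l))"
      using Cons.prems by (simp add: letter_flip letter_closed)
    also have "\<dots> = star A (foldr (\<lambda>l y. letter_eval A h l \<otimes> y) ls \<one>) \<otimes> star A (letter_eval A h l)"
      using foldr_mult[OF sub star_closed[OF lc]] Cons.IH lsub by (simp only:)
    also have "\<dots> = star A (foldr (\<lambda>l y. letter_eval A h l \<otimes> y) (l # ls) \<one>)"
      using Cons.prems by (simp add: letter_closed foldr_closed star_mult)
    finally show ?case .
  qed simp
  from this[of "letters w"] w show ?thesis
    by (simp add: word_eval_def word_adj_def)
qed

lemma keys_WX: "f \<in> free_star_algebra X \<Longrightarrow> Poly_Mapping.keys f \<subseteq> WX"
  by (auto simp: free_star_algebra_def)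

lemma ev_superset:
  assumes "finite W" "Poly_Mapping.keys f \<subseteq> W" "W \<subseteq> WX"
  shows "ev f = (\<Oplus>w\<in>W. Poly_Mapping.lookup f w \<odot> wev w)"
  unfolding star_eval_def
proof (rule add.finprod_mono_neutral_cong_left)
  show "Poly_Mapping.lookup f w \<odot> wev w = \<zero>" if "w \<in> W - Poly_Mapping.keys f" for w
    using assms that by (auto simp: in_keys_iff intro!: smult_0 word_closed)
  show "(\<lambda>w. Poly_Mapping.lookup f w \<odot> wev w) \<in> W \<rightarrow> carrier A"
    using assms by (auto intro!: smult_closed word_closed)
qed (use assms in auto)

lemma ev_closed: "f \<in> free_star_algebra X \<Longrightarrow> ev f \<in> carrier A"
  unfolding star_eval_def using keys_WX[of f] by (auto intro!: finsum_closed smult_closed word_closed)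

lemma ev_add:
  assumes f: "f \<in> free_star_algebra X" and g: "g \<in> free_star_algebra X"
  shows "ev (f + g) = ev f \<oplus> ev g"
proof -
  let ?W = "Poly_Mapping.keys f \<union> Poly_Mapping.keys g"
  have W: "finite ?W" "?W \<subseteq> WX" using keys_WX[OF f] keys_WX[OF g] by auto
  have cl: "(\<lambda>w. c w \<odot> wev w) \<in> ?W \<rightarrow> carrier A" for c
    by (intro Pi_I smult_closed word_closed subsetD[OF W(2)])
  have "ev (f + g) = (\<Oplus>w\<in>?W. Poly_Mapping.lookup (f + g) w \<odot> wev w)"
    using W Poly_Mapping.keys_add by (intro ev_superset)
  also have "\<dots> = (\<Oplus>w\<in>?W. Poly_Mapping.lookup f w \<odot> wev w \<oplus> Poly_Mapping.lookup g w \<odot> wev w)"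
    by (intro finsum_cong' Pi_I a_closed smult_closed word_closed subsetD[OF W(2)] refl;
      (assumption | unfold lookup_add, rule smult_add_left, rule word_closed, erule subsetD[OF W(2)]))
  also have "\<dots> = (\<Oplus>w\<in>?W. Poly_Mapping.lookup f w \<odot> wev w) \<oplus> (\<Oplus>w\<in>?W. Poly_Mapping.lookup g w \<odot> wev w)"
    using cl by (intro finsum_addf)
  also have "\<dots> = ev f \<oplus> ev g"
    using W ev_superset[of ?W f] ev_superset[of ?W g] by simp
  finally show ?thesis .
qed

lemma ev_single: "w \<in> WX \<Longrightarrow> ev (Poly_Mapping.single w c) = c \<odot> wev w"
  using ev_superset[of "{w}" "Poly_Mapping.single w c"] by (simp add: word_closed)

lemma ev_0: "ev 0 = \<zero>"
  by (simp add: star_eval_def)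

lemma ev_cst: "ev (cst c) = c \<odot> \<one>"
  unfolding cst_def by (subst ev_single) (simp_all add: zero_word_def word_eval_def)

lemma ev_1: "ev 1 = \<one>"
  using ev_cst[of 1] by simp

lemma ev_gen: "x \<in> X \<Longrightarrow> ev (gen x) = h x"
  unfolding gen_def by (subst ev_single) (simp_all add: word_eval_def h_closed)

lemma ev_mult:
  assumes f: "f \<in> free_star_algebra X" and g: "g \<in> free_star_algebra X"
  shows "ev (f * g) = ev f \<otimes> ev g"
  using f
proof (induction f rule: free_add_induct)
  case zero
  then show ?case using ev_closed[OF g] by (simp add: ev_0)
next
  case (add v c f)
  note v = free_single[OF add(1)]
  have "ev (Poly_Mapping.single v c * g) = ev (Poly_Mapping.single v c) \<otimes> ev g"
    using g
  proof (induction g rule: free_add_induct)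
    case zero
    then show ?case using ev_closed[OF v, of c] by (simp add: ev_0)
  next
    case (add w d g)
    note w = free_single[OF add(1)]
    have vw: "v + w \<in> WX" using \<open>base ` set (letters v) \<subseteq> X\<close> add(1) by (auto simp: plus_word_def)
    have "ev (Poly_Mapping.single v c * (Poly_Mapping.single w d + g)) =
        ev (Poly_Mapping.single (v + w) (c * d)) \<oplus> ev (Poly_Mapping.single v c * g)"
      using v w add(2) vw by (simp add: distrib_left mult_single ev_add free_single)
    also have "ev (Poly_Mapping.single (v + w) (c * d)) =
        ev (Poly_Mapping.single v c) \<otimes> ev (Poly_Mapping.single w d)"
      using vw \<open>base ` set (letters v) \<subseteq> X\<close> add(1)
      by (simp add: ev_single word_add word_closed smult_mult_left smult_mult_right smult_assoc[symmetric] mult.commute)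
    finally show ?case
      using v w add by (simp add: ev_add r_distr ev_closed)
  qed
  then show ?case
    using v g add by (simp add: distrib_right ev_add ev_closed l_distr)
qed

lemma ev_adj: "f \<in> free_star_algebra X \<Longrightarrow> ev (adj f) = star A (ev f)"
proof (induction f rule: free_add_induct)
  case zero
  then show ?case by (simp add: ev_0)
next
  case (add w c f)
  note w = free_single[OF add(1)]
  have "word_adj w \<in> WX" using add(1) by (simp add: word_adj_def image_image)
  then have "ev (adj (Poly_Mapping.single w c)) = star A (ev (Poly_Mapping.single w c))"
    using add(1) by (simp add: adj_single ev_single word_adj star_smult word_closed)
  then show ?case using add w by (simp add: adj_add ev_add ev_closed star_add)
qed

lemma ev_cst_mult: "f \<in> free_star_algebra X \<Longrightarrow> ev (cst c * f) = c \<odot> ev f"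
  by (simp add: ev_mult ev_cst ev_closed smult_mult_left)

lemma ev_minus:
  assumes "f \<in> free_star_algebra X" "g \<in> free_star_algebra X"
  shows "ev (f - g) = ev f \<ominus> ev g"
proof -
  have "f - g = f + cst (-1) * g" by (simp add: cst_minus_1)
  then show ?thesis using assms
    by (simp only: ev_add ev_cst_mult free_mult free_cst) (simp add: a_minus_def minus_smult ev_closed)
qed

lemma ev_seminorm: "cstar_seminorm X (\<lambda>f. nrm A (ev f))"
  unfolding cstar_seminorm_def
  by (simp add: ev_closed nrm_nonneg ev_cst smult_mult_left nrm_smult ev_mult ev_adj nrm_star_mult ev_add
      nrm_triangle nrm_mult)

end


context cstar_algebra
begin

definition conv :: "(nat \<Rightarrow> 'a) \<Rightarrow> 'a \<Rightarrow> bool"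
  where "conv s x \<longleftrightarrow> (\<forall>n. s n \<in> carrier A) \<and> x \<in> carrier A \<and> (\<lambda>n. nrm A (s n \<ominus> x)) \<longlonglongrightarrow> 0"

lemma conv_squeeze:
  assumes "\<And>n. s n \<in> carrier A" "x \<in> carrier A" "f \<longlonglongrightarrow> 0" "\<And>n. nrm A (s n \<ominus> x) \<le> f n"
  shows "conv s x"
proof -
  have "(\<lambda>n. nrm A (s n \<ominus> x)) \<longlonglongrightarrow> 0"
    by (rule tendsto_sandwich[OF _ _ tendsto_const assms(3)]) (simp_all add: assms nrm_nonneg)
  with assms show ?thesis by (simp add: conv_def)
qed

lemma conv_unique: "\<lbrakk>conv s x; conv s y\<rbrakk> \<Longrightarrow> x = y"
proof -
  assume x: "conv s x" and y: "conv s y"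
  have le: "nrm A (x \<ominus> y) \<le> nrm A (s n \<ominus> x) + nrm A (s n \<ominus> y)" for n
    using nrm_diff_triangle[of x "s n" y] nrm_diff_commute[of x "s n"] x y by (simp add: conv_def)
  have "(\<lambda>n. nrm A (s n \<ominus> x) + nrm A (s n \<ominus> y)) \<longlonglongrightarrow> 0"
    using x y by (intro tendsto_add_zero) (simp_all add: conv_def)
  then have "nrm A (x \<ominus> y) \<le> 0" by (rule LIMSEQ_le_const) (simp add: le)
  then have "x \<ominus> y = \<zero>"
    using nrm_nonneg[of "x \<ominus> y"] nrm_eq_0_iff[of "x \<ominus> y"] x y by (simp add: conv_def)
  then show ?thesis using x y by (auto simp: conv_def intro: diff_eq_zero)
qed

lemma conv_const: "x \<in> carrier A \<Longrightarrow> conv (\<lambda>n. x) x"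
  by (simp add: conv_def r_neg a_minus_def)

lemma conv_add: "\<lbrakk>conv s x; conv t y\<rbrakk> \<Longrightarrow> conv (\<lambda>n. s n \<oplus> t n) (x \<oplus> y)"
proof (rule conv_squeeze)
  assume s: "conv s x" and t: "conv t y"
  then have cl: "s n \<in> carrier A" "t n \<in> carrier A" "x \<in> carrier A" "y \<in> carrier A" for n
    by (simp_all add: conv_def)
  show "(\<lambda>n. nrm A (s n \<ominus> x) + nrm A (t n \<ominus> y)) \<longlonglongrightarrow> 0"
    using s t by (intro tendsto_add_zero) (simp_all add: conv_def)
  show "nrm A (s n \<oplus> t n \<ominus> (x \<oplus> y)) \<le> nrm A (s n \<ominus> x) + nrm A (t n \<ominus> y)" for n
  proof -
    have "s n \<oplus> t n \<ominus> (x \<oplus> y) = (s n \<ominus> x) \<oplus> (t n \<ominus> y)"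
      using cl(1)[of n] cl(2)[of n] cl(3,4) by algebra
    with cl show ?thesis using nrm_triangle[of "s n \<ominus> x" "t n \<ominus> y"] by simp
  qed
qed (simp_all add: conv_def)

lemma smult_minus_right: "\<lbrakk>x \<in> carrier A; y \<in> carrier A\<rbrakk> \<Longrightarrow> c \<odot> x \<ominus> c \<odot> y = c \<odot> (x \<ominus> y)"
  by (simp add: a_minus_def minus_smult smult_add_right smult_assoc[symmetric] mult.commute)

lemma star_minus: "\<lbrakk>x \<in> carrier A; y \<in> carrier A\<rbrakk> \<Longrightarrow> star A (x \<ominus> y) = star A x \<ominus> star A y"
  by (simp add: a_minus_def minus_smult star_add star_smult)

lemma conv_smult: "conv s x \<Longrightarrow> conv (\<lambda>n. c \<odot> s n) (c \<odot> x)"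
  using tendsto_mult_right_zero[of "\<lambda>n. nrm A (s n \<ominus> x)" sequentially "cmod c"]
  by (simp add: conv_def smult_minus_right nrm_smult)

lemma conv_star: "conv s x \<Longrightarrow> conv (\<lambda>n. star A (s n)) (star A x)"
  by (simp add: conv_def star_minus[symmetric] nrm_star)

lemma conv_bounded: "conv s x \<Longrightarrow> \<exists>M. \<forall>n. nrm A (s n) \<le> M"
proof -
  assume s: "conv s x"
  then have "Bseq (\<lambda>n. nrm A (s n \<ominus> x))" by (auto simp: conv_def intro!: convergent_imp_Bseq convergentI)
  then obtain K where K: "\<And>n. norm (nrm A (s n \<ominus> x)) \<le> K" by (auto simp: Bseq_def)
  have "nrm A (s n) \<le> K + nrm A x" for n
  proof -
    have cl: "s n \<in> carrier A" "x \<in> carrier A" using s by (simp_all add: conv_def)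
    then have "s n = (s n \<ominus> x) \<oplus> x" by algebra
    with cl K[of n] show ?thesis using nrm_triangle[of "s n \<ominus> x" x] by simp
  qed
  then show ?thesis by blast
qed

lemma conv_mult: "\<lbrakk>conv s x; conv t y\<rbrakk> \<Longrightarrow> conv (\<lambda>n. s n \<otimes> t n) (x \<otimes> y)"
proof -
  assume s: "conv s x" and t: "conv t y"
  then have cl: "s n \<in> carrier A" "t n \<in> carrier A" "x \<in> carrier A" "y \<in> carrier A" for n
    by (simp_all add: conv_def)
  from conv_bounded[OF t] obtain M where M: "\<And>n. nrm A (t n) \<le> M" by blast
  show ?thesis
  proof (rule conv_squeeze)
    show "(\<lambda>n. nrm A (s n \<ominus> x) * M + nrm A x * nrm A (t n \<ominus> y)) \<longlonglongrightarrow> 0"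
      using s t by (intro tendsto_add_zero tendsto_mult_left_zero tendsto_mult_right_zero)
        (simp_all add: conv_def)
    show "nrm A (s n \<otimes> t n \<ominus> x \<otimes> y) \<le> nrm A (s n \<ominus> x) * M + nrm A x * nrm A (t n \<ominus> y)" for n
    proof -
      have "s n \<otimes> t n \<ominus> x \<otimes> y = (s n \<ominus> x) \<otimes> t n \<oplus> x \<otimes> (t n \<ominus> y)"
        using cl(1)[of n] cl(2)[of n] cl(3,4) by algebra
      then have "nrm A (s n \<otimes> t n \<ominus> x \<otimes> y) \<le> nrm A ((s n \<ominus> x) \<otimes> t n) + nrm A (x \<otimes> (t n \<ominus> y))"
        using nrm_triangle[of "(s n \<ominus> x) \<otimes> t n" "x \<otimes> (t n \<ominus> y)"] cl by simp
      also have "\<dots> \<le> nrm A (s n \<ominus> x) * nrm A (t n) + nrm A x * nrm A (t n \<ominus> y)"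
        using cl by (intro add_mono nrm_mult) simp_all
      also have "\<dots> \<le> nrm A (s n \<ominus> x) * M + nrm A x * nrm A (t n \<ominus> y)"
        using cl M by (intro add_mono mult_left_mono order_refl nrm_nonneg) simp_all
      finally show ?thesis .
    qed
  qed (use cl in simp_all)
qed

end


locale universal_extension = bounded_presentation X R + star_evaluation A X h
  for X :: "'x set" and R and A :: "'a star_algebra" (structure) and h +
  assumes rels: "r \<in> R \<Longrightarrow> ev r = \<zero>"
begin

lemma ev_le: "f \<in> F \<Longrightarrow> nrm A (ev f) \<le> u f"
  by (rule u_upper[of "\<lambda>f. nrm A (ev f)"]) (simp_all add: admissible_def ev_seminorm rels)

lemma ev_S_conv: "s \<in> carrier S \<Longrightarrow> \<exists>x. conv (\<lambda>n. ev (s n)) x"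
proof -
  assume s: "s \<in> carrier S"
  have "\<exists>x\<in>carrier A. (\<lambda>n. nrm A (ev (s n) \<ominus> x)) \<longlonglongrightarrow> 0"
  proof (rule complete)
    show "ev (s n) \<in> carrier A" for n using S_F[OF s] by (rule ev_closed)
    fix \<epsilon> :: real assume "0 < \<epsilon>"
    from S_Cauchy[OF s this] obtain K where K: "\<forall>m\<ge>K. \<forall>n\<ge>K. u (s m - s n) < \<epsilon>" ..
    have "nrm A (ev (s m) \<ominus> ev (s n)) \<le> u (s m - s n)" for m n
      using ev_le[of "s m - s n"] S_F[OF s] by (simp add: ev_minus)
    with K show "\<exists>N. \<forall>m\<ge>N. \<forall>n\<ge>N. nrm A (ev (s m) \<ominus> ev (s n)) < \<epsilon>"
      by (meson le_less_trans)
  qed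
  then show ?thesis using S_F[OF s] by (auto simp: conv_def ev_closed)
qed

lemma ev_N_conv:
  assumes s: "s \<in> carrier S" and t: "t \<in> cls s" and c: "conv (\<lambda>n. ev (s n)) x"
  shows "conv (\<lambda>n. ev (t n)) x"
proof (rule conv_squeeze)
  have F: "t n \<in> F" "s n \<in> F" for n using s t by (simp_all add: mem_cls S_F)
  show "ev (t n) \<in> carrier A" for n by (rule ev_closed[OF F(1)])
  show x: "x \<in> carrier A" using c by (simp add: conv_def)
  show "(\<lambda>n. u (t n - s n) + nrm A (ev (s n) \<ominus> x)) \<longlonglongrightarrow> 0"
    using s t c by (intro tendsto_add_zero) (simp_all add: conv_def mem_cls N_iff)
  show "nrm A (ev (t n) \<ominus> x) \<le> u (t n - s n) + nrm A (ev (s n) \<ominus> x)" for n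
    using nrm_diff_triangle[of "ev (t n)" "ev (s n)" x] ev_le[of "t n - s n"] x F
    by (simp add: ev_closed ev_minus)
qed

definition ext :: "(nat \<Rightarrow> 'x free_star) set \<Rightarrow> 'a"
  where "ext Z = (THE x. \<exists>s\<in>Z. conv (\<lambda>n. ev (s n)) x)"

lemma ext_eq: "\<lbrakk>s \<in> carrier S; conv (\<lambda>n. ev (s n)) x\<rbrakk> \<Longrightarrow> ext (cls s) = x"
  unfolding ext_def
  by (rule the_equality) (use cls_self ev_N_conv conv_unique in blast)+

lemma ext_conv: "s \<in> carrier S \<Longrightarrow> conv (\<lambda>n. ev (s n)) (ext (cls s))"
  using ev_S_conv ext_eq by metis

lemma ext_const: "f \<in> F \<Longrightarrow> ext (cls (\<lambda>n. f)) = ev f"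
  by (intro ext_eq S_const conv_const ev_closed)

lemma ext_star_hom: "ext \<in> star_hom U A"
  unfolding star_hom_def
proof (intro CollectI conjI ballI allI ring_hom_memI)
  fix z assume "z \<in> carrier U"
  then obtain s where s: "s \<in> carrier S" and z: "z = cls s" by (rule U_cases)
  have F: "s n \<in> F" for n by (rule S_F[OF s])
  note cs = ext_conv[OF s]
  show "ext z \<in> carrier A" using cs by (simp add: z conv_def)
  show "ext (c \<odot>\<^bsub>U\<^esub> z) = c \<odot> ext z" for c
    unfolding z U_smult[OF s] using conv_smult[OF cs] F by (intro ext_eq S_cst s) (simp add: ev_cst_mult)
  show "ext (star U z) = star A (ext z)"
    unfolding z U_star[OF s] using conv_star[OF cs] F by (intro ext_eq S_adj s) (simp add: ev_adj)
  fix y assume "y \<in> carrier U"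
  then obtain t where t: "t \<in> carrier S" and y: "y = cls t" by (rule U_cases)
  have G: "t n \<in> F" for n by (rule S_F[OF t])
  note ct = ext_conv[OF t]
  show "ext (z \<otimes>\<^bsub>U\<^esub> y) = ext z \<otimes> ext y"
    unfolding z y U_mult[OF s t] using conv_mult[OF cs ct] F G by (intro ext_eq S_mult s t) (simp add: ev_mult)
  show "ext (z \<oplus>\<^bsub>U\<^esub> y) = ext z \<oplus> ext y"
    unfolding z y U_add[OF s t] using conv_add[OF cs ct] F G by (intro ext_eq S_add s t) (simp add: ev_add)
next
  show "ext \<one>\<^bsub>U\<^esub> = \<one>" by (simp add: U_one ext_const ev_1)
qed

lemma ext_gen: "x \<in> X \<Longrightarrow> ext (universal_gen X R x) = h x"
  by (simp add: universal_gen_def ext_const ev_gen)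

end

context bounded_presentation
begin

lemma gen_carrier: "x \<in> X \<Longrightarrow> universal_gen X R x \<in> carrier U"
  by (simp add: universal_gen_def U_cls S_const)

lemma star_evaluation_universal: "star_evaluation U X (universal_gen X R)"
  by (intro star_evaluation.intro cstar_algebra_universal star_evaluation_axioms.intro gen_carrier)

lemma eval_universal: "f \<in> F \<Longrightarrow> star_eval U (universal_gen X R) f = cls (\<lambda>n. f)"
proof (induction f rule: free_induct)
  interpret E: star_evaluation U X "universal_gen X R" by (rule star_evaluation_universal)
  case (cst c)
  then show ?case by (simp add: E.ev_cst U_one U_smult S_const)
next
  interpret E: star_evaluation U X "universal_gen X R" by (rule star_evaluation_universal)
  case (gen x)
  then show ?case by (simp add: E.ev_gen) (simp add: universal_gen_def)
next
  interpret E: star_evaluation U X "universal_gen X R" by (rule star_evaluation_universal)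
  case (adj x)
  then show ?case by (simp add: E.ev_gen E.ev_adj) (simp add: universal_gen_def U_star S_const)
next
  interpret E: star_evaluation U X "universal_gen X R" by (rule star_evaluation_universal)
  case (add f g)
  then show ?case by (simp add: E.ev_add U_add S_const)
next
  interpret E: star_evaluation U X "universal_gen X R" by (rule star_evaluation_universal)
  case (mult f g)
  then show ?case by (simp add: E.ev_mult U_mult S_const)
qed

theorem universal_rels: "r \<in> R \<Longrightarrow> star_eval U (universal_gen X R) r = \<zero>\<^bsub>U\<^esub>"
  using rels_free by (simp add: eval_universal subsetD U_zero cls_eq S_const N_iff u_rel)

lemma universal_dense:
  assumes "z \<in> carrier U" "0 < \<epsilon>"
  shows "\<exists>f\<in>F. nrm U (z \<ominus>\<^bsub>U\<^esub> star_eval U (universal_gen X R) f) < \<epsilon>"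
proof -
  from assms(1) obtain s where s: "s \<in> carrier S" and z: "z = cls s" by (rule U_cases)
  from assms(2) have "0 < \<epsilon> / 2" by simp
  from S_Cauchy[OF s this] obtain K where K: "\<forall>m\<ge>K. \<forall>n\<ge>K. u (s m - s n) < \<epsilon> / 2" ..
  have F: "s K \<in> F" by (rule S_F[OF s])
  have "(\<lambda>n. u (s n - s K)) \<longlonglongrightarrow> nrm U (z \<ominus>\<^bsub>U\<^esub> cls (\<lambda>n. s K))"
    using U_nrm[OF S_minus[OF s S_const[OF F]]] s F by (simp add: z U_minus S_const)
  then have "nrm U (z \<ominus>\<^bsub>U\<^esub> cls (\<lambda>n. s K)) \<le> \<epsilon> / 2"
    by (rule LIMSEQ_le_const2) (use K in \<open>auto intro: less_imp_le\<close>)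
  then show ?thesis using F assms(2) by (intro bexI[of _ "s K"]) (simp_all add: eval_universal)
qed

theorem universal_ex:
  assumes "cstar_algebra B" "\<And>x. x \<in> X \<Longrightarrow> h x \<in> carrier B"
    and "\<And>r. r \<in> R \<Longrightarrow> star_eval B h r = \<zero>\<^bsub>B\<^esub>"
  shows "\<exists>\<phi>\<in>star_hom U B. \<forall>x\<in>X. \<phi> (universal_gen X R x) = h x"
proof -
  interpret E: universal_extension X R B h
    using assms by (intro universal_extension.intro star_evaluation.intro bounded_presentation_axioms
      star_evaluation_axioms.intro universal_extension_axioms.intro)
  show ?thesis using E.ext_star_hom E.ext_gen by blast
qed

end


lemma isometry_bound:
  assumes p: "cstar_seminorm X p" and v: "v \<in> free_star_algebra X" and z: "p (adj v * v - 1) = 0"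
  shows "p v \<le> 1"
proof -
  have "(p v)\<^sup>2 = p ((adj v * v - 1) + 1)" using seminorm_star[OF p v] by simp
  also have "\<dots> \<le> p (adj v * v - 1) + p 1" by (rule seminorm_add[OF p]) (simp_all add: v)
  also have "\<dots> \<le> 1" using z seminorm_1[OF p] by simp
  finally show ?thesis using seminorm_nonneg[OF p v] by (simp add: power_le_one_iff)
qed

lemma projection_bound:
  assumes p: "cstar_seminorm X p" and e: "e \<in> free_star_algebra X"
    and z: "p (adj e - e) = 0" "p (e * e - e) = 0"
  shows "p e \<le> 1"
proof -
  have nn: "0 \<le> p e" by (rule seminorm_nonneg[OF p e])
  have eq: "adj e * e = (adj e - e) * e + ((e * e - e) + e)" by (simp add: algebra_simps)
  have "(p e)\<^sup>2 = p (adj e * e)" using seminorm_star[OF p e] by simp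
  also have "\<dots> \<le> p ((adj e - e) * e) + p ((e * e - e) + e)"
    unfolding eq by (rule seminorm_add[OF p]) (simp_all add: e)
  also have "\<dots> \<le> p (adj e - e) * p e + (p (e * e - e) + p e)"
    by (intro add_mono seminorm_add[OF p] seminorm_mult[OF p]) (simp_all add: e)
  finally have "p e * p e \<le> 1 * p e" using z by (simp add: power2_eq_square)
  then show ?thesis using nn by (cases "p e = 0") auto
qed

context quasi_lattice_ordered
begin

lemma bounded_presentation_nica: "bounded_presentation P (nica_rels G P)"
proof
  show "nica_rels G P \<subseteq> free_star_algebra P"
    by (auto simp: nica_rels_def mult_mem)
  show "\<exists>M. \<forall>p. admissible P (nica_rels G P) p \<longrightarrow> p (gen x) \<le> M" if x: "x \<in> P" for x
  proof (intro exI allI impI)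
    fix p :: "'a free_star \<Rightarrow> real" assume "admissible P (nica_rels G P) p"
    then show "p (gen x) \<le> 1"
      using x by (intro isometry_bound[of P]) (auto simp: admissible_def nica_rels_def)
  qed
qed

lemma bounded_presentation_semigroup: "bounded_presentation (semigroup_gens G P) (semigroup_rels G P)"
proof
  have V: "gen (V p) \<in> free_star_algebra (semigroup_gens G P)" if "p \<in> P" for p
    using that by (intro free_gen) (simp add: semigroup_gens_def)
  have E: "gen (E Y) \<in> free_star_algebra (semigroup_gens G P)" if "Y \<in> constructible_ideals G P" for Y
    using that by (intro free_gen) (simp add: semigroup_gens_def)
  show "semigroup_rels G P \<subseteq> free_star_algebra (semigroup_gens G P)"
    by (auto simp: semigroup_rels_def Let_def V E mult_mem constructible_ideals.intros)
  show "\<exists>M. \<forall>p. admissible (semigroup_gens G P) (semigroup_rels G P) p \<longrightarrow> p (gen x) \<le> M"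
    if x: "x \<in> semigroup_gens G P" for x
  proof (intro exI allI impI)
    fix p :: "'a semigroup_gen free_star \<Rightarrow> real"
    assume ad: "admissible (semigroup_gens G P) (semigroup_rels G P) p"
    from x consider g where "x = V g" "g \<in> P" | Y where "x = E Y" "Y \<in> constructible_ideals G P"
      by (auto simp: semigroup_gens_def)
    then show "p (gen x) \<le> 1"
    proof cases
      case 1
      then have "adj (gen x) * gen x - 1 \<in> semigroup_rels G P"
        unfolding semigroup_rels_def Let_def by blast
      with ad V[of g] 1 show ?thesis
        by (intro isometry_bound[of "semigroup_gens G P"]) (simp_all add: admissible_def)
    next
      case 2
      then have "adj (gen x) - gen x \<in> semigroup_rels G P" "gen x * gen x - gen x \<in> semigroup_rels G P"
        unfolding semigroup_rels_def Let_def by blast+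
      with ad E[of Y] 2 show ?thesis
        by (intro projection_bound[of "semigroup_gens G P"]) (simp_all add: admissible_def)
    qed
  qed
qed

end

end

(*
  The relations of each presentation hold for the generators of the other algebra: every
  constructible ideal is empty or of the form pP with unique p, so e_{pP} can be sent to
  v(p) v(p)*, and conversely e_{pP} = v_p e_P v_p* = v_p v_p*. The universal properties yield
  *-homomorphisms in both directions, and uniqueness of *-homomorphisms with given values on the
  generators shows that they are mutually inverse. Uniqueness needs automatic continuity, which
  is obtained without spectral theory: a self-adjoint h of norm at most 1/2 is the real part of
  the unitary h + i sqrt(1 - h^2), and *-homomorphisms map unitaries to elements of norm at most 1.
*)

theory Submission
  imports Defs
begin

section \<open>Square roots of \<open>\<one> - a\<close> and real parts of isometries\<close>

context cstar_algebra
begin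

lemma nrm_one_le: "nrm A \<one> \<le> 1"
proof -
  have "nrm A \<one> * nrm A \<one> = nrm A \<one>"
    using nrm_star_mult[of \<one>] by (simp add: power2_eq_square)
  then show ?thesis by auto
qed

lemma nrm_isometry_le:
  assumes u: "u \<in> carrier A" and "star A u \<otimes> u = \<one>"
  shows "nrm A u \<le> 1"
proof -
  have "(nrm A u)\<^sup>2 \<le> 1" using nrm_star_mult[OF u] assms(2) nrm_one_le by simp
  then show ?thesis using nrm_nonneg[OF u] by (simp add: power_le_one_iff)
qed

text \<open>Comparing a term only with later ones is the form that an induction along an iteration
  yields; symmetry of the distance supplies the rest of the Cauchy condition.\<close>

lemma conv_CauchyI:
  assumes cl: "\<And>n. s n \<in> carrier A" and f: "f \<longlonglongrightarrow> 0"
    and le: "\<And>n k. nrm A (s (n + k) \<ominus> s n) \<le> f n"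
  shows "\<exists>x. conv s x"
proof -
  have "\<exists>N. \<forall>m\<ge>N. \<forall>n\<ge>N. nrm A (s m \<ominus> s n) < \<epsilon>" if "0 < \<epsilon>" for \<epsilon>
  proof -
    from order_tendstoD(2)[OF f that] obtain N where N: "\<And>n. n \<ge> N \<Longrightarrow> f n < \<epsilon>"
      by (auto simp: eventually_sequentially)
    have "nrm A (s m \<ominus> s n) < \<epsilon>" if "m \<ge> N" "n \<ge> N" for m n
    proof (cases "n \<le> m")
      case True
      then show ?thesis using le[of n "m - n"] N[OF that(2)] by simp
    next
      case False
      then show ?thesis
        using le[of m "n - m"] N[OF that(1)] by (simp add: nrm_diff_commute[OF cl cl, of m n])
    qed
    then show ?thesis by blast
  qed
  from complete[OF cl this] cl show ?thesis by (auto simp: conv_def)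
qed

lemma conv_Suc: "conv s x \<Longrightarrow> conv (\<lambda>n. s (Suc n)) x"
  by (auto simp: conv_def intro: LIMSEQ_Suc)

text \<open>Picard iteration for \<open>c = (a + c\<^sup>2) / 2\<close>; then \<open>1 - c\<close> is a square root of \<open>1 - a\<close>.\<close>

primrec sqrt_iter :: "'a \<Rightarrow> nat \<Rightarrow> 'a"
  where "sqrt_iter a 0 = \<zero>"
  | "sqrt_iter a (Suc n) = (1/2) \<odot> (a \<oplus> sqrt_iter a n \<otimes> sqrt_iter a n)"

lemma sqrt_iter_closed [simp]: "a \<in> carrier A \<Longrightarrow> sqrt_iter a n \<in> carrier A"
  by (induction n) simp_all

text \<open>The iteration maps the ball of radius 1/2 into itself: half of 1/2 + 1/4 is 3/8.\<close>

lemma sqrt_iter_le: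
  assumes a: "a \<in> carrier A" "nrm A a \<le> 1/2"
  shows "nrm A (sqrt_iter a n) \<le> 1/2"
proof (induction n)
  case (Suc n)
  let ?c = "sqrt_iter a n"
  have c: "?c \<in> carrier A" using a by simp
  have "nrm A (a \<oplus> ?c \<otimes> ?c) \<le> nrm A a + nrm A ?c * nrm A ?c"
    using nrm_triangle[of a "?c \<otimes> ?c"] nrm_mult[of ?c ?c] a c by simp
  also have "\<dots> \<le> 1/2 + 1/2 * (1/2)"
    using a Suc nrm_nonneg[OF c] by (intro add_mono mult_mono) auto
  finally show ?case using a by (simp add: nrm_smult)
qed simp

text \<open>A difference of squares splits as (d - c)d + c(d - c), also without commutativity. As
  both factors c and d have norm at most 1/2, this does not exceed the norm of d - c, and the scalar
  1/2 of the iteration gives the contraction.\<close>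

lemma sqrt_iter_Cauchy:
  assumes a: "a \<in> carrier A" "nrm A a \<le> 1/2"
  shows "nrm A (sqrt_iter a (n + k) \<ominus> sqrt_iter a n) \<le> (1/2) ^ n"
proof (induction n)
  case 0
  then show ?case using sqrt_iter_le[OF a, of k] a by (simp add: a_minus_def)
next
  case (Suc n)
  let ?c = "sqrt_iter a n" and ?d = "sqrt_iter a (n + k)"
  have cl: "?c \<in> carrier A" "?d \<in> carrier A" using a by simp_all
  have eq: "(a \<oplus> ?d \<otimes> ?d) \<ominus> (a \<oplus> ?c \<otimes> ?c) = (?d \<ominus> ?c) \<otimes> ?d \<oplus> ?c \<otimes> (?d \<ominus> ?c)"
    using cl a(1) by algebra
  have "nrm A ((a \<oplus> ?d \<otimes> ?d) \<ominus> (a \<oplus> ?c \<otimes> ?c)) \<le>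
      nrm A (?d \<ominus> ?c) * nrm A ?d + nrm A ?c * nrm A (?d \<ominus> ?c)"
    unfolding eq using cl by (intro order_trans[OF nrm_triangle] add_mono nrm_mult) simp_all
  also have "\<dots> \<le> (1/2) ^ n * (1/2) + 1/2 * (1/2) ^ n"
    using Suc sqrt_iter_le[OF a] cl by (intro add_mono mult_mono) (simp_all add: nrm_nonneg)
  finally have "nrm A ((a \<oplus> ?d \<otimes> ?d) \<ominus> (a \<oplus> ?c \<otimes> ?c)) \<le> (1/2) ^ n" by simp
  then show ?case using cl a by (simp add: smult_minus_right nrm_smult)
qed

text \<open>The limit c of the iteration satisfies 2c = a + c c, so b = 1 - c has b b = 1 - a.
  Self-adjointness and commutation with \<open>h\<close> hold for every iterate and survive the
  limit. The extra element \<open>h\<close> prepares for the case where \<open>a\<close> is its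
  square.\<close>

lemma ex_sqrt_one_minus:
  assumes a: "a \<in> carrier A" "star A a = a" "nrm A a \<le> 1/2"
    and h: "h \<in> carrier A" "h \<otimes> a = a \<otimes> h"
  shows "\<exists>b\<in>carrier A. star A b = b \<and> h \<otimes> b = b \<otimes> h \<and> a \<oplus> b \<otimes> b = \<one>"
proof -
  let ?c = "sqrt_iter a"
  have "(\<lambda>n. (1/2) ^ n :: real) \<longlonglongrightarrow> 0" by (rule LIMSEQ_power_zero) simp
  with sqrt_iter_Cauchy[OF a(1,3)] a(1) obtain c where c: "conv ?c c"
    using conv_CauchyI[of ?c "\<lambda>n. (1/2) ^ n"] by auto
  then have cc: "c \<in> carrier A" by (simp add: conv_def)
  have "conv (\<lambda>n. ?c (Suc n)) ((1/2) \<odot> (a \<oplus> c \<otimes> c))"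
    unfolding sqrt_iter.simps using a by (intro conv_smult conv_add conv_mult conv_const c)
  from conv_unique[OF conv_Suc[OF c] this] have eq: "c = (1/2) \<odot> (a \<oplus> c \<otimes> c)" .
  have "c \<oplus> c = 2 \<odot> c" using cc smult_add_left[of c 1 1] by simp
  also have "\<dots> = a \<oplus> c \<otimes> c"
    by (subst eq) (use a cc in \<open>simp add: smult_assoc[symmetric]\<close>)
  finally have sum: "c \<oplus> c = a \<oplus> c \<otimes> c" .
  have "star A (?c n) = ?c n" for n
    by (induction n) (use a in \<open>simp_all add: star_smult star_add star_mult\<close>)
  with conv_star[OF c] have "conv ?c (star A c)" by simp
  from conv_unique[OF this c] have star: "star A c = c" .
  have com: "h \<otimes> ?c n = ?c n \<otimes> h" for n
  proof (induction n)
    case (Suc n)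
    have cn: "?c n \<in> carrier A" using a by simp
    have "h \<otimes> (?c n \<otimes> ?c n) = (?c n \<otimes> ?c n) \<otimes> h"
      using m_assoc[of h "?c n" "?c n"] m_assoc[of "?c n" h "?c n"] m_assoc[of "?c n" "?c n" h]
        Suc cn h by simp
    then show ?case using cn a h
      by (simp add: smult_mult_left smult_mult_right l_distr r_distr)
  qed (use h in simp)
  have "conv (\<lambda>n. h \<otimes> ?c n) (h \<otimes> c)" using c h by (intro conv_mult conv_const)
  moreover have "conv (\<lambda>n. ?c n \<otimes> h) (c \<otimes> h)" using c h by (intro conv_mult conv_const)
  ultimately have hc: "h \<otimes> c = c \<otimes> h" unfolding com by (rule conv_unique)
  show ?thesis
  proof (intro bexI conjI)
    show "star A (\<one> \<ominus> c) = \<one> \<ominus> c" using cc star by (simp add: star_minus)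
    show "h \<otimes> (\<one> \<ominus> c) = (\<one> \<ominus> c) \<otimes> h"
      using cc h hc by (simp add: a_minus_def l_distr r_distr l_minus r_minus)
    \<comment> \<open>The grouping isolates the right-hand side of the fixed-point equation
      \<open>sum\<close>; after its replacement all but the unit cancels.\<close>
    have "a \<oplus> (\<one> \<ominus> c) \<otimes> (\<one> \<ominus> c) = \<one> \<oplus> (a \<oplus> c \<otimes> c) \<ominus> (c \<oplus> c)"
      using cc a(1) by (simp add: a_minus_def l_distr r_distr l_minus r_minus minus_add a_ac)
    also have "\<dots> = \<one> \<oplus> (c \<oplus> c) \<ominus> (c \<oplus> c)" unfolding sum ..
    also have "\<dots> = \<one>" using cc by algebra
    finally show "a \<oplus> (\<one> \<ominus> c) \<otimes> (\<one> \<ominus> c) = \<one>" .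
  qed (use cc in simp)
qed

text \<open>Norm at most 1/2 puts the square of \<open>h\<close> within reach of the square root
  lemma. For u = h + i b the mixed terms of \<open>star A u \<otimes> u\<close> cancel because
  \<open>h\<close> and \<open>b\<close> commute.\<close>

lemma self_adjoint_real_part_isometry:
  assumes h: "h \<in> carrier A" "star A h = h" "nrm A h \<le> 1/2"
  shows "\<exists>u\<in>carrier A. star A u \<otimes> u = \<one> \<and> h = (1/2) \<odot> (u \<oplus> star A u)"
proof -
  have "nrm A (h \<otimes> h) \<le> 1/2 * (1/2)"
    using nrm_mult[of h h] mult_mono[of "nrm A h" "1/2" "nrm A h" "1/2"] h nrm_nonneg[of h] by simp
  then have "nrm A (h \<otimes> h) \<le> 1/2" by simp
  with h obtain b where b: "b \<in> carrier A" "star A b = b" "h \<otimes> b = b \<otimes> h" "h \<otimes> h \<oplus> b \<otimes> b = \<one>"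
    using ex_sqrt_one_minus[of "h \<otimes> h" h] by (auto simp: star_mult m_assoc)
  let ?u = "h \<oplus> \<i> \<odot> b"
  let ?d = "\<i> \<odot> (h \<otimes> b)"
  have us: "star A ?u = h \<oplus> (- \<i>) \<odot> b"
    using h b by (simp add: star_add star_smult)
  \<comment> \<open>Used in both directions: reversed to match the expanded product, forwards to let
    the additive group rules cancel.\<close>
  have neg: "(- c) \<odot> x = \<ominus> (c \<odot> x)" if "x \<in> carrier A" for c x
    using that by (simp add: minus_smult smult_assoc[symmetric])
  have bh: "b \<otimes> h = h \<otimes> b" using b(3) by simp
  have "star A ?u \<otimes> ?u = (h \<otimes> h \<oplus> ?d) \<oplus> (\<ominus> ?d \<oplus> b \<otimes> b)"
    using h(1) b(1) by (simp add: us l_distr r_distr smult_mult_left smult_mult_right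
        smult_add_right smult_assoc[symmetric] neg[symmetric] bh a_ac)
  also have "\<dots> = h \<otimes> h \<oplus> b \<otimes> b"
    using h(1) b(1) by (simp add: a_ac r_neg r_neg1 r_neg2)
  finally have "star A ?u \<otimes> ?u = \<one>" using b by simp
  moreover have "(1/2) \<odot> (?u \<oplus> star A ?u) = h"
  proof -
    have "?u \<oplus> star A ?u = h \<oplus> h"
      using h(1) b(1) by (simp add: us neg a_ac r_neg r_neg1 r_neg2)
    also have "\<dots> = 2 \<odot> h" using h smult_add_left[of h 1 1] by simp
    finally show ?thesis using h by (simp add: smult_assoc[symmetric])
  qed
  ultimately show ?thesis using h b by (intro bexI[of _ ?u]) simp_all
qed

end

section \<open>Algebra and continuity of *-homomorphisms\<close>

lemma
  assumes "\<phi> \<in> star_hom A B"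
  shows star_hom_closed: "x \<in> carrier A \<Longrightarrow> \<phi> x \<in> carrier B"
    and star_hom_add: "\<lbrakk>x \<in> carrier A; y \<in> carrier A\<rbrakk> \<Longrightarrow> \<phi> (x \<oplus>\<^bsub>A\<^esub> y) = \<phi> x \<oplus>\<^bsub>B\<^esub> \<phi> y"
    and star_hom_mult: "\<lbrakk>x \<in> carrier A; y \<in> carrier A\<rbrakk> \<Longrightarrow> \<phi> (x \<otimes>\<^bsub>A\<^esub> y) = \<phi> x \<otimes>\<^bsub>B\<^esub> \<phi> y"
    and star_hom_one: "\<phi> \<one>\<^bsub>A\<^esub> = \<one>\<^bsub>B\<^esub>"
    and star_hom_smult: "x \<in> carrier A \<Longrightarrow> \<phi> (c \<odot>\<^bsub>A\<^esub> x) = c \<odot>\<^bsub>B\<^esub> \<phi> x"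
    and star_hom_star: "x \<in> carrier A \<Longrightarrow> \<phi> (star A x) = star B (\<phi> x)"
  using assms by (auto simp: star_hom_def ring_hom_add ring_hom_mult ring_hom_one intro: ring_hom_closed)

lemma star_hom_comp:
  assumes f: "\<phi> \<in> star_hom A B" and g: "\<psi> \<in> star_hom B C"
  shows "\<psi> \<circ> \<phi> \<in> star_hom A C"
  using ring_hom_trans[of \<phi> A B \<psi> C] assms by (auto simp: star_hom_def ring_hom_closed[of \<phi> A B])

lemma star_hom_id: "id \<in> star_hom A A"
  by (simp add: star_hom_def ring_hom_def)

text \<open>Membership in \<open>star_hom\<close> speaks of sums and scalars but not of differences;
  these are reached through the scalar -1, just as zero is reached below through the scalar
  0.\<close>

lemma star_hom_minus:
  assumes A: "cstar_algebra A" and B: "cstar_algebra B" and f: "\<phi> \<in> star_hom A B"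
    and x: "x \<in> carrier A" and y: "y \<in> carrier A"
  shows "\<phi> (x \<ominus>\<^bsub>A\<^esub> y) = \<phi> x \<ominus>\<^bsub>B\<^esub> \<phi> y"
proof -
  interpret A: cstar_algebra A by fact
  interpret B: cstar_algebra B by fact
  show ?thesis using f x y
    by (simp add: a_minus_def A.minus_smult B.minus_smult star_hom_closed star_hom_add star_hom_smult)
qed

lemma star_hom_zero:
  assumes A: "cstar_algebra A" and B: "cstar_algebra B" and f: "\<phi> \<in> star_hom A B"
  shows "\<phi> \<zero>\<^bsub>A\<^esub> = \<zero>\<^bsub>B\<^esub>"
proof -
  interpret A: cstar_algebra A by fact
  interpret B: cstar_algebra B by fact
  show ?thesis using star_hom_smult[OF f, of "\<zero>\<^bsub>A\<^esub>" 0] star_hom_closed[OF f] by simp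
qed

text \<open>
  Real parts of isometries have norm at most 1, and the isometry identity is preserved by \<open>\<phi>\<close>.
\<close>

lemma star_hom_bounded:
  assumes A: "cstar_algebra A" and B: "cstar_algebra B" and f: "\<phi> \<in> star_hom A B"
    and x: "x \<in> carrier A"
  shows "nrm B (\<phi> x) \<le> 2 * nrm A x"
proof -
  interpret A: cstar_algebra A by fact
  interpret B: cstar_algebra B by fact
  note hom = star_hom_closed[OF f] star_hom_add[OF f] star_hom_mult[OF f] star_hom_one[OF f]
    star_hom_smult[OF f] star_hom_star[OF f]
  have half: "nrm B (\<phi> h) \<le> 1"
    if h: "h \<in> carrier A" "star A h = h" "nrm A h \<le> 1/2" for h
  proof -
    from A.self_adjoint_real_part_isometry[OF h] obtain u where
      u: "u \<in> carrier A" "star A u \<otimes>\<^bsub>A\<^esub> u = \<one>\<^bsub>A\<^esub>" "h = (1/2) \<odot>\<^bsub>A\<^esub> (u \<oplus>\<^bsub>A\<^esub> star A u)" by blast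
    have "star B (\<phi> u) \<otimes>\<^bsub>B\<^esub> \<phi> u = \<phi> (star A u \<otimes>\<^bsub>A\<^esub> u)" using u(1) by (simp add: hom)
    then have "nrm B (\<phi> u) \<le> 1" using u by (intro B.nrm_isometry_le) (simp_all add: hom)
    moreover have "\<phi> h = (1/2) \<odot>\<^bsub>B\<^esub> (\<phi> u \<oplus>\<^bsub>B\<^esub> star B (\<phi> u))" using u by (simp add: hom)
    ultimately show ?thesis
      using B.nrm_triangle[of "\<phi> u" "star B (\<phi> u)"] u by (simp add: hom B.nrm_smult B.nrm_star)
  qed
  have sa: "nrm B (\<phi> h) \<le> 2 * nrm A h" if h: "h \<in> carrier A" "star A h = h" for h
  proof (cases "nrm A h = 0")
    case True
    then show ?thesis using h star_hom_zero[OF A B f] by (simp add: A.nrm_eq_0_iff)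
  next
    case False
    \<comment> \<open>Rescales \<open>h\<close> to norm exactly 1/2, where \<open>half\<close>
      applies. Norm zero is split off because \<open>t\<close> would then be 0.\<close>
    define t where "t = 1 / (2 * nrm A h)"
    have t: "t > 0" "nrm A h * t = 1/2" using False A.nrm_nonneg[OF h(1)] by (simp_all add: t_def)
    have "nrm B (\<phi> (of_real t \<odot>\<^bsub>A\<^esub> h)) \<le> 1"
      using h t by (intro half) (simp_all add: A.star_smult A.nrm_smult mult.commute)
    then have "t * nrm B (\<phi> h) \<le> 1" using h t by (simp add: hom B.nrm_smult)
    then show ?thesis using t False A.nrm_nonneg[OF h(1)] by (simp add: t_def field_simps)
  qed
  \<comment> \<open>The C*-identity in both algebras reduces the general case to the self-adjoint
    \<open>star A x \<otimes> x\<close>; the factor 2 on squares is below the square of 2.\<close>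
  have "(nrm B (\<phi> x))\<^sup>2 = nrm B (\<phi> (star A x \<otimes>\<^bsub>A\<^esub> x))"
    using x by (simp add: hom B.nrm_star_mult)
  also have "\<dots> \<le> 2 * (nrm A x)\<^sup>2"
    using sa[of "star A x \<otimes>\<^bsub>A\<^esub> x"] x by (simp add: A.star_mult A.nrm_star_mult)
  also have "\<dots> \<le> (2 * nrm A x)\<^sup>2" by (simp add: power_mult_distrib)
  finally show ?thesis using A.nrm_nonneg[OF x] by (intro power2_le_imp_le[of "nrm B (\<phi> x)"]) simp_all
qed

section \<open>Homomorphisms are determined by the generators\<close>

context bounded_presentation
begin

text \<open>Agreement spreads from the generators to all *-polynomials by induction, and from these
  to the whole algebra by density and the norm bound.\<close>

lemma star_hom_unique:
  assumes B: "cstar_algebra B" and f: "\<phi> \<in> star_hom U B" and g: "\<psi> \<in> star_hom U B"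
    and gens: "\<And>x. x \<in> X \<Longrightarrow> \<phi> (universal_gen X R x) = \<psi> (universal_gen X R x)"
    and z: "z \<in> carrier U"
  shows "\<phi> z = \<psi> z"
proof -
  interpret B: cstar_algebra B by fact
  interpret E: star_evaluation U X "universal_gen X R" by (rule star_evaluation_universal)
  note Ucs = cstar_algebra_universal
  note hom = star_hom_add star_hom_mult star_hom_one star_hom_smult star_hom_star
  have eq: "\<phi> (E.ev a) = \<psi> (E.ev a)" if "a \<in> F" for a
    using that
  proof (induction a rule: free_induct)
    case (cst c)
    then show ?case using hom[OF f] hom[OF g] by (simp add: E.ev_cst)
  next
    case (gen x)
    then show ?case by (simp add: E.ev_gen gens)
  next
    case (adj x)
    then show ?case using hom[OF f] hom[OF g] by (simp add: E.ev_gen E.ev_adj gens gen_carrier)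
  next
    case (add a b)
    then show ?case using hom[OF f] hom[OF g] by (simp add: E.ev_add E.ev_closed)
  next
    case (mult a b)
    then show ?case using hom[OF f] hom[OF g] by (simp add: E.ev_mult E.ev_closed)
  qed
  have fz: "\<phi> z \<in> carrier B" and gz: "\<psi> z \<in> carrier B"
    by (rule star_hom_closed[OF f z], rule star_hom_closed[OF g z])
  \<comment> \<open>The summand 0 gives the shape of \<open>field_le_epsilon\<close>. Approximation
    within e/4 becomes e/2 under the bound with factor 2, once for each homomorphism.\<close>
  have "nrm B (\<phi> z \<ominus>\<^bsub>B\<^esub> \<psi> z) \<le> 0 + e" if "0 < e" for e
  proof -
    have "0 < e / 4" using that by simp
    from universal_dense[OF z this] obtain a where
      a: "a \<in> F" "nrm U (z \<ominus>\<^bsub>U\<^esub> E.ev a) < e / 4" by blast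
    have ac: "E.ev a \<in> carrier U" using a by (simp add: E.ev_closed)
    have le: "nrm B (\<chi> z \<ominus>\<^bsub>B\<^esub> \<chi> (E.ev a)) \<le> e / 2" if "\<chi> \<in> star_hom U B" for \<chi>
      using star_hom_bounded[OF Ucs B that, of "z \<ominus>\<^bsub>U\<^esub> E.ev a"]
        star_hom_minus[OF Ucs B that z ac] a z ac by simp
    have "nrm B (\<phi> z \<ominus>\<^bsub>B\<^esub> \<psi> z) \<le>
        nrm B (\<phi> z \<ominus>\<^bsub>B\<^esub> \<phi> (E.ev a)) + nrm B (\<phi> (E.ev a) \<ominus>\<^bsub>B\<^esub> \<psi> z)"
      by (rule B.nrm_diff_triangle[OF fz star_hom_closed[OF f ac] gz])
    also have "nrm B (\<phi> (E.ev a) \<ominus>\<^bsub>B\<^esub> \<psi> z) = nrm B (\<psi> z \<ominus>\<^bsub>B\<^esub> \<psi> (E.ev a))"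
      using gz star_hom_closed[OF g ac] by (simp add: eq[OF a(1)] B.nrm_diff_commute)
    finally show ?thesis using le[OF f] le[OF g] by simp
  qed
  then have "nrm B (\<phi> z \<ominus>\<^bsub>B\<^esub> \<psi> z) \<le> 0" by (rule field_le_epsilon)
  then have "\<phi> z \<ominus>\<^bsub>B\<^esub> \<psi> z = \<zero>\<^bsub>B\<^esub>"
    using B.nrm_nonneg[of "\<phi> z \<ominus>\<^bsub>B\<^esub> \<psi> z"] B.nrm_eq_0_iff[of "\<phi> z \<ominus>\<^bsub>B\<^esub> \<psi> z"] fz gz by simp
  then show ?thesis by (rule B.diff_eq_zero[OF fz gz])
qed

end

context cstar_algebra
begin

lemma diff_eq_zero_iff: "\<lbrakk>x \<in> carrier A; y \<in> carrier A\<rbrakk> \<Longrightarrow> x \<ominus> y = \<zero> \<longleftrightarrow> x = y"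
  using diff_eq_zero[of x y] by (auto simp: a_minus_def r_neg)

text \<open>Multiplying \<open>v \<otimes> v = v\<close> by the adjoint cancels one factor. This is
  how the isometry at the unit of \<open>P\<close> is seen to be the identity, which
  \<open>nica_rels\<close> does not list as a relation.\<close>

lemma isometry_idem_eq_one:
  assumes v: "v \<in> carrier A" "star A v \<otimes> v = \<one>" "v \<otimes> v = v"
  shows "v = \<one>"
proof -
  have "v = (star A v \<otimes> v) \<otimes> v" using v by simp
  also have "\<dots> = star A v \<otimes> (v \<otimes> v)" using v(1) by (simp add: m_assoc)
  finally show ?thesis using v by simp
qed

end

section \<open>Constructible ideals are empty or principal\<close>

context quasi_lattice_ordered
begin

lemma mem_carrier: "p \<in> P \<Longrightarrow> p \<in> carrier G"
  using subset by blast

lemma mem_translate: "p \<in> P \<Longrightarrow> p \<in> p <# P"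
  using one_mem r_one[OF mem_carrier] unfolding l_coset_def by force

lemma translate_subset: "p \<in> P \<Longrightarrow> p <# P \<subseteq> P"
  by (auto simp: l_coset_def mult_mem)

lemma translate_translate: "\<lbrakk>p \<in> P; q \<in> P\<rbrakk> \<Longrightarrow> p <# (q <# P) = (p \<otimes> q) <# P"
  by (simp add: lcos_m_assoc subset mem_carrier)

lemma translate_one: "\<one> <# P = P"
  by (simp add: lcos_mult_one subset)

lemma translate_empty [simp]: "p <# {} = {}"
  by (simp add: l_coset_def)

lemma unit_eq_one:
  assumes x: "x \<in> P" and y: "y \<in> P" and "x \<otimes> y = \<one>"
  shows "x = \<one>"
proof -
  have "x = inv y" using assms mem_carrier inv_equality by simp
  with x y have "x \<in> P \<inter> (\<lambda>p. inv p) ` P" by blast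
  then show ?thesis unfolding inverses by simp
qed

text \<open>Each element is a multiple of the other, p = q x and q = p y, so x y is the unit and x
  is invertible within \<open>P\<close>, hence trivial. Thus an ideal p P determines its
  generator.\<close>

lemma translate_inject:
  assumes p: "p \<in> P" and q: "q \<in> P" and eq: "p <# P = q <# P"
  shows "p = q"
proof -
  note c = mem_carrier[OF p] mem_carrier[OF q]
  obtain x where x: "x \<in> P" "p = q \<otimes> x"
    using mem_translate[OF p] unfolding eq by (auto simp: l_coset_def)
  obtain y where y: "y \<in> P" "q = p \<otimes> y"
    using mem_translate[OF q] unfolding eq[symmetric] by (auto simp: l_coset_def)
  have cx: "x \<in> carrier G" and cy: "y \<in> carrier G" using x y mem_carrier by blast+
  have "q \<otimes> (x \<otimes> y) = p \<otimes> y" unfolding x(2) using c cx cy by (simp add: m_assoc)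
  also have "\<dots> = q \<otimes> \<one>" using y(2) c by simp
  finally have "x \<otimes> y = \<one>" using c cx cy by simp
  then have "x = \<one>" by (rule unit_eq_one[OF x(1) y(1)])
  then show ?thesis using x c by simp
qed

lemma Int_translates:
  assumes "x \<in> carrier G" "y \<in> carrier G"
  shows "P \<inter> ((x <# P) \<inter> (y <# P)) = {} \<or> (\<exists>r\<in>P. P \<inter> ((x <# P) \<inter> (y <# P)) = r <# P)"
proof -
  have "{1..2::nat} = {1, 2}" by auto
  then show ?thesis
    using quasi_lattice[of 2 "\<lambda>i. if i = 1 then x else y"] assms by simp
qed

text \<open>Preimages are the delicate case: that of q P under p is the part in \<open>P\<close> of
  the translate by \<open>inv p \<otimes> q\<close>. This element may lie outside \<open>P\<close>,
  so the axiom is applied to translates by group elements.\<close>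

lemma constructible_ideals_cases:
  assumes "X \<in> constructible_ideals G P"
  obtains "X = {}" | p where "p \<in> P" "X = p <# P"
proof -
  from assms have "X = {} \<or> (\<exists>p\<in>P. X = p <# P)"
  proof induction
    case whole
    then show ?case using one_mem translate_one by metis
  next
    case (translate X p)
    then show ?case using translate_translate mult_mem by auto
  next
    case (preimage X p)
    have "{y \<in> P. p \<otimes> y \<in> q <# P} = P \<inter> ((inv p \<otimes> q) <# P)" if q: "q \<in> P" for q
    proof -
      note c = mem_carrier[OF preimage(2)] mem_carrier[OF q]
      have "p \<otimes> y = q \<otimes> x \<longleftrightarrow> y = inv p \<otimes> q \<otimes> x" if "y \<in> P" "x \<in> P" for x y
        using c mem_carrier[OF that(1)] mem_carrier[OF that(2)] inv_solve_left[of y p "q \<otimes> x"]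
        by (auto simp: m_assoc)
      then show ?thesis by (auto simp: l_coset_def)
    qed
    \<comment> \<open>A single translate is treated as its intersection with itself.\<close>
    moreover have "P \<inter> ((inv p \<otimes> q) <# P) = {} \<or> (\<exists>r\<in>P. P \<inter> ((inv p \<otimes> q) <# P) = r <# P)"
      if "q \<in> P" for q
      using Int_translates[of "inv p \<otimes> q" "inv p \<otimes> q"] mem_carrier preimage(2) that by simp
    ultimately show ?case using preimage.IH by (elim disjE bexE) simp_all
  next
    case (inter X Y)
    have "(p <# P) \<inter> (q <# P) = {} \<or> (\<exists>r\<in>P. (p <# P) \<inter> (q <# P) = r <# P)" if "p \<in> P" "q \<in> P" for p q
    proof -
      have "P \<inter> ((p <# P) \<inter> (q <# P)) = (p <# P) \<inter> (q <# P)"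
        using translate_subset[OF that(1)] by blast
      then show ?thesis using Int_translates[OF that[THEN mem_carrier]] by simp
    qed
    with inter show ?case by auto
  qed simp
  then show thesis using that by blast
qed

lemma translate_constructible: "p \<in> P \<Longrightarrow> p <# P \<in> constructible_ideals G P"
  by (intro constructible_ideals.intros)

section \<open>Passing between the two sets of relations\<close>

definition range_proj :: "'c star_algebra \<Rightarrow> ('a \<Rightarrow> 'c) \<Rightarrow> 'a set \<Rightarrow> 'c"
  where "range_proj B w X =
    (if X = {} then \<zero>\<^bsub>B\<^esub> else let p = THE p. p \<in> P \<and> X = p <# P in w p \<otimes>\<^bsub>B\<^esub> star B (w p))"

definition nica_assign :: "'c star_algebra \<Rightarrow> ('a \<Rightarrow> 'c) \<Rightarrow> 'a semigroup_gen \<Rightarrow> 'c"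
  where "nica_assign B w = case_semigroup_gen w (range_proj B w)"

lemma range_proj_empty: "range_proj B w {} = \<zero>\<^bsub>B\<^esub>"
  by (simp add: range_proj_def)

text \<open>By \<open>translate_inject\<close> the description in \<open>range_proj\<close> selects
  \<open>p\<close>; the branch for the empty ideal is avoided since \<open>p\<close> lies in its own
  translate.\<close>

lemma range_proj_translate: "p \<in> P \<Longrightarrow> range_proj B w (p <# P) = w p \<otimes>\<^bsub>B\<^esub> star B (w p)"
proof -
  assume p: "p \<in> P"
  then have "(THE q. q \<in> P \<and> p <# P = q <# P) = p"
    by (intro the_equality) (auto intro: translate_inject)
  then show ?thesis using mem_translate[OF p] by (auto simp: range_proj_def)
qed

text \<open>Nica's two relations on range projections say together that \<open>range_proj\<close>
  turns intersections into products. Multiplicativity of \<open>w\<close> gives the relation for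
  translates, and \<open>P\<close> being the translate by the unit gives the value one
  there.\<close>

lemma nica_assign_rels:
  assumes B: "cstar_algebra B" and w: "\<And>p. p \<in> P \<Longrightarrow> w p \<in> carrier B"
    and rels: "\<And>r. r \<in> nica_rels G P \<Longrightarrow> star_eval B w r = \<zero>\<^bsub>B\<^esub>"
  shows "X \<in> constructible_ideals G P \<Longrightarrow> range_proj B w X \<in> carrier B"
    and "r \<in> semigroup_rels G P \<Longrightarrow> star_eval B (nica_assign B w) r = \<zero>\<^bsub>B\<^esub>"
proof -
  interpret N: star_evaluation B P w
    using B w by (intro star_evaluation.intro star_evaluation_axioms.intro)
  note N_simps = N.ev_minus N.ev_mult N.ev_gen N.ev_adj N.ev_1 N.diff_eq_zero_iff
  have isom: "star B (w p) \<otimes>\<^bsub>B\<^esub> w p = \<one>\<^bsub>B\<^esub>" if p: "p \<in> P" for p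
  proof -
    have "adj (gen p) * gen p - 1 \<in> nica_rels G P" using p by (auto simp: nica_rels_def)
    from rels[OF this] show ?thesis using p by (simp add: N_simps w)
  qed
  have mult: "w (p \<otimes> q) = w p \<otimes>\<^bsub>B\<^esub> w q" if p: "p \<in> P" "q \<in> P" for p q
  proof -
    have "gen p * gen q - gen (p \<otimes> q) \<in> nica_rels G P" using p unfolding nica_rels_def by blast
    from rels[OF this] show ?thesis using p by (simp add: N_simps w mult_mem)
  qed
  have meet: "w p \<otimes>\<^bsub>B\<^esub> star B (w p) \<otimes>\<^bsub>B\<^esub> (w q \<otimes>\<^bsub>B\<^esub> star B (w q)) = w r \<otimes>\<^bsub>B\<^esub> star B (w r)"
    if p: "p \<in> P" "q \<in> P" "r \<in> P" "(p <# P) \<inter> (q <# P) = r <# P" for p q r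
  proof -
    have "gen p * adj (gen p) * (gen q * adj (gen q)) - gen r * adj (gen r) \<in> nica_rels G P"
      using p unfolding nica_rels_def by blast
    from rels[OF this] show ?thesis using p by (simp add: N_simps w)
  qed
  have disj: "w p \<otimes>\<^bsub>B\<^esub> star B (w p) \<otimes>\<^bsub>B\<^esub> (w q \<otimes>\<^bsub>B\<^esub> star B (w q)) = \<zero>\<^bsub>B\<^esub>"
    if p: "p \<in> P" "q \<in> P" "(p <# P) \<inter> (q <# P) = {}" for p q
  proof -
    have "gen p * adj (gen p) * (gen q * adj (gen q)) \<in> nica_rels G P"
      using p unfolding nica_rels_def by blast
    from rels[OF this] show ?thesis using p by (simp add: N_simps w)
  qed
  have w_one: "w \<one> = \<one>\<^bsub>B\<^esub>"
    using mult[OF one_mem one_mem] by (intro N.isometry_idem_eq_one[OF w isom] one_mem) simp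
  show closed: "range_proj B w X \<in> carrier B" if "X \<in> constructible_ideals G P" for X
    using that by (rule constructible_ideals_cases) (simp_all add: range_proj_empty range_proj_translate w)
  have "nica_assign B w x \<in> carrier B" if "x \<in> semigroup_gens G P" for x
    using that by (auto simp: semigroup_gens_def nica_assign_def w closed)
  then interpret S: star_evaluation B "semigroup_gens G P" "nica_assign B w"
    using B by (intro star_evaluation.intro star_evaluation_axioms.intro)
  have V: "V p \<in> semigroup_gens G P" "nica_assign B w (V p) = w p" if "p \<in> P" for p
    using that by (simp_all add: semigroup_gens_def nica_assign_def)
  have E: "E X \<in> semigroup_gens G P" "nica_assign B w (E X) = range_proj B w X"
    if "X \<in> constructible_ideals G P" for X
    using that by (simp_all add: semigroup_gens_def nica_assign_def)
  note J = constructible_ideals.intros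
  note S_simps = S.ev_minus S.ev_mult S.ev_gen S.ev_adj S.ev_1 N.diff_eq_zero_iff V E w closed
  have sa: "star B (range_proj B w X) = range_proj B w X" if "X \<in> constructible_ideals G P" for X
    using that by (rule constructible_ideals_cases)
      (simp_all add: range_proj_empty range_proj_translate w N.star_mult)
  have inter: "range_proj B w (X \<inter> Y) = range_proj B w X \<otimes>\<^bsub>B\<^esub> range_proj B w Y"
    if X: "X \<in> constructible_ideals G P" and Y: "Y \<in> constructible_ideals G P" for X Y
  proof (cases "X = {} \<or> Y = {}")
    case True
    then show ?thesis using closed[OF X] closed[OF Y] by (auto simp: range_proj_empty)
  next
    case False
    then obtain p q where pq: "p \<in> P" "X = p <# P" "q \<in> P" "Y = q <# P"
      using X Y by (metis constructible_ideals_cases)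
    from J(5)[OF X Y] show ?thesis
    proof (rule constructible_ideals_cases)
      assume "X \<inter> Y = {}"
      then show ?thesis using disj[of p q] pq by (simp add: range_proj_empty range_proj_translate)
    next
      fix r assume "r \<in> P" "X \<inter> Y = r <# P"
      then show ?thesis using meet[of p q r] pq by (simp add: range_proj_translate)
    qed
  qed
  have trans: "range_proj B w (p <# X) = w p \<otimes>\<^bsub>B\<^esub> range_proj B w X \<otimes>\<^bsub>B\<^esub> star B (w p)"
    if X: "X \<in> constructible_ideals G P" and p: "p \<in> P" for X p
    using X
  proof (rule constructible_ideals_cases)
    assume "X = {}"
    then show ?thesis using w[OF p] by (simp add: range_proj_empty)
  next
    fix q assume "q \<in> P" "X = q <# P"
    then show ?thesis using p
      by (simp add: translate_translate range_proj_translate mult_mem mult w N.star_mult N.m_assoc)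
  qed
  have whole: "range_proj B w P = \<one>\<^bsub>B\<^esub>"
    using range_proj_translate[OF one_mem, of B w] by (simp add: translate_one w_one)
  assume "r \<in> semigroup_rels G P"
  then show "star_eval B (nica_assign B w) r = \<zero>\<^bsub>B\<^esub>"
    unfolding semigroup_rels_def Let_def
  proof (elim UnE)
    assume "r \<in> {adj (gen (V p)) * gen (V p) - 1 | p. p \<in> P}"
    then show ?thesis by (auto simp: S_simps isom)
  next
    assume "r \<in> {adj (gen (E X)) - gen (E X) | X. X \<in> constructible_ideals G P}"
    then show ?thesis by (auto simp: S_simps sa)
  next
    \<comment> \<open>Idempotence is the rule \<open>inter\<close> for an ideal intersected with
      itself.\<close>
    assume "r \<in> {gen (E X) * gen (E X) - gen (E X) | X. X \<in> constructible_ideals G P}"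
    then show ?thesis by (auto simp: S_simps inter[symmetric])
  next
    assume "r \<in> {gen (V (p \<otimes> q)) - gen (V p) * gen (V q) | p q. p \<in> P \<and> q \<in> P}"
    then show ?thesis by (auto simp: S_simps mult mult_mem)
  next
    assume "r \<in> {gen (V p) * gen (E X) * adj (gen (V p)) - gen (E (p <# X)) | p X.
      p \<in> P \<and> X \<in> constructible_ideals G P}"
    then show ?thesis by (auto simp: S_simps trans J)
  next
    assume "r \<in> {gen (E P) - 1, gen (E {})}"
    then show ?thesis by (auto simp: S_simps J whole range_proj_empty)
  next
    assume "r \<in> {gen (E (X \<inter> Y)) - gen (E X) * gen (E Y) | X Y.
      X \<in> constructible_ideals G P \<and> Y \<in> constructible_ideals G P}"
    then show ?thesis by (auto simp: S_simps inter J)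
  qed
qed

text \<open>Conjugating the projection of \<open>P\<close>, which is the identity, by the isometry
  at \<open>p\<close> gives its range projection. Equations between intersections of ideals thereby
  become Nica's relations.\<close>

lemma semigroup_relations:
  assumes B: "cstar_algebra B" and g: "\<And>x. x \<in> semigroup_gens G P \<Longrightarrow> g x \<in> carrier B"
    and rels: "\<And>r. r \<in> semigroup_rels G P \<Longrightarrow> star_eval B g r = \<zero>\<^bsub>B\<^esub>"
  shows semigroup_range: "p \<in> P \<Longrightarrow> g (E (p <# P)) = g (V p) \<otimes>\<^bsub>B\<^esub> star B (g (V p))"
    and semigroup_empty: "g (E {}) = \<zero>\<^bsub>B\<^esub>"
    and semigroup_nica_rels: "r \<in> nica_rels G P \<Longrightarrow> star_eval B (g \<circ> V) r = \<zero>\<^bsub>B\<^esub>"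
proof -
  interpret S: star_evaluation B "semigroup_gens G P" g
    using B g by (intro star_evaluation.intro star_evaluation_axioms.intro)
  have V: "V p \<in> semigroup_gens G P" if "p \<in> P" for p
    using that by (simp add: semigroup_gens_def)
  have E: "E X \<in> semigroup_gens G P" if "X \<in> constructible_ideals G P" for X
    using that by (simp add: semigroup_gens_def)
  interpret N: star_evaluation B P "g \<circ> V"
    using B g V by (intro star_evaluation.intro star_evaluation_axioms.intro) simp_all
  note J = constructible_ideals.intros
  note S_simps = S.ev_minus S.ev_mult S.ev_gen S.ev_adj S.ev_1 S.diff_eq_zero_iff V E g
  have isom: "star B (g (V p)) \<otimes>\<^bsub>B\<^esub> g (V p) = \<one>\<^bsub>B\<^esub>" if p: "p \<in> P" for p
  proof -
    have "adj (gen (V p)) * gen (V p) - 1 \<in> semigroup_rels G P"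
      using p unfolding semigroup_rels_def Let_def by blast
    from rels[OF this] show ?thesis using p by (simp add: S_simps)
  qed
  have mult: "g (V (p \<otimes> q)) = g (V p) \<otimes>\<^bsub>B\<^esub> g (V q)" if p: "p \<in> P" "q \<in> P" for p q
  proof -
    have "gen (V (p \<otimes> q)) - gen (V p) * gen (V q) \<in> semigroup_rels G P"
      using p unfolding semigroup_rels_def Let_def by blast
    from rels[OF this] show ?thesis using p by (simp add: S_simps mult_mem)
  qed
  have inter: "g (E (X \<inter> Y)) = g (E X) \<otimes>\<^bsub>B\<^esub> g (E Y)"
    if X: "X \<in> constructible_ideals G P" "Y \<in> constructible_ideals G P" for X Y
  proof -
    have "gen (E (X \<inter> Y)) - gen (E X) * gen (E Y) \<in> semigroup_rels G P"
      using X unfolding semigroup_rels_def Let_def by blast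
    from rels[OF this] show ?thesis using X by (simp add: S_simps J)
  qed
  have "gen (E P) - 1 \<in> semigroup_rels G P" "gen (E {}) \<in> semigroup_rels G P"
    unfolding semigroup_rels_def Let_def by blast+
  from this[THEN rels] have whole: "g (E P) = \<one>\<^bsub>B\<^esub>" and empty: "g (E {}) = \<zero>\<^bsub>B\<^esub>"
    by (simp_all add: S_simps J)
  then show "g (E {}) = \<zero>\<^bsub>B\<^esub>" by simp
  show range: "g (E (p <# P)) = g (V p) \<otimes>\<^bsub>B\<^esub> star B (g (V p))" if p: "p \<in> P" for p
  proof -
    have "gen (V p) * gen (E P) * adj (gen (V p)) - gen (E (p <# P)) \<in> semigroup_rels G P"
      using p J(1)[of P G] unfolding semigroup_rels_def Let_def by blast
    from rels[OF this] show ?thesis using p by (simp add: S_simps J whole)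
  qed
  have gV: "g (V p) \<in> carrier B" if "p \<in> P" for p using that by (intro g V)
  note N_simps = N.ev_minus N.ev_mult N.ev_gen N.ev_adj N.ev_1 S.diff_eq_zero_iff gV
  assume "r \<in> nica_rels G P"
  then show "star_eval B (g \<circ> V) r = \<zero>\<^bsub>B\<^esub>"
    unfolding nica_rels_def
  proof (elim UnE)
    assume "r \<in> {adj (gen p) * gen p - 1 | p. p \<in> P}"
    then show ?thesis by (auto simp: N_simps isom)
  next
    assume "r \<in> {gen p * gen q - gen (p \<otimes> q) | p q. p \<in> P \<and> q \<in> P}"
    then show ?thesis by (auto simp: N_simps mult mult_mem)
  next
    assume "r \<in> {gen p * adj (gen p) * (gen q * adj (gen q)) - gen r * adj (gen r) | p q r.
      p \<in> P \<and> q \<in> P \<and> r \<in> P \<and> (p <# P) \<inter> (q <# P) = r <# P}"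
    then obtain p q s where r: "r = gen p * adj (gen p) * (gen q * adj (gen q)) - gen s * adj (gen s)"
      and p: "p \<in> P" "q \<in> P" "s \<in> P" "(p <# P) \<inter> (q <# P) = s <# P" by blast
    then show ?thesis
      using inter[OF translate_constructible translate_constructible, of p q]
      by (simp add: N_simps range)
  next
    assume "r \<in> {gen p * adj (gen p) * (gen q * adj (gen q)) | p q.
      p \<in> P \<and> q \<in> P \<and> (p <# P) \<inter> (q <# P) = {}}"
    then obtain p q where r: "r = gen p * adj (gen p) * (gen q * adj (gen q))"
      and p: "p \<in> P" "q \<in> P" "(p <# P) \<inter> (q <# P) = {}" by blast
    then show ?thesis
      using inter[OF translate_constructible translate_constructible, of p q]
      by (simp add: N_simps range empty)
  qed
qed

end

section \<open>The mutually inverse homomorphisms\<close>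

theorem mainTheorem2:
  fixes G :: "('g, 'm) monoid_scheme" and P :: "'g set"
  assumes "quasi_lattice_ordered G P"
  defines "A \<equiv> full_semigroup_cstar G P" and "B \<equiv> nica_cstar G P"
    and "v \<equiv> semigroup_v G P" and "e \<equiv> semigroup_e G P" and "w \<equiv> nica_v G P"
  shows "\<exists>\<phi>\<in>star_iso A B.
    (\<forall>p\<in>P. \<phi> (v p) = w p) \<and> \<phi> (e {}) = \<zero>\<^bsub>B\<^esub> \<and>
    (\<forall>p\<in>P. \<phi> (e (p <#\<^bsub>G\<^esub> P)) = w p \<otimes>\<^bsub>B\<^esub> star B (w p)) \<and>
    (\<forall>\<phi>'\<in>star_hom A B.
      (\<forall>p\<in>P. \<phi>' (v p) = w p) \<and> \<phi>' (e {}) = \<zero>\<^bsub>B\<^esub> \<and>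
      (\<forall>p\<in>P. \<phi>' (e (p <#\<^bsub>G\<^esub> P)) = w p \<otimes>\<^bsub>B\<^esub> star B (w p)) \<longrightarrow>
      (\<forall>x\<in>carrier A. \<phi>' x = \<phi> x)) \<and>
    (\<exists>\<psi>\<in>star_hom B A.
      (\<forall>x\<in>carrier A. \<psi> (\<phi> x) = x) \<and> (\<forall>y\<in>carrier B. \<phi> (\<psi> y) = y) \<and>
      (\<forall>p\<in>P. \<psi> (w p) = v p) \<and>
      (\<forall>\<psi>'\<in>star_hom B A. (\<forall>p\<in>P. \<psi>' (w p) = v p) \<longrightarrow> (\<forall>y\<in>carrier B. \<psi>' y = \<psi> y)))"
proof -
  interpret quasi_lattice_ordered G P by fact
  interpret SA: bounded_presentation "semigroup_gens G P" "semigroup_rels G P"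
    by (rule bounded_presentation_semigroup)
  interpret NB: bounded_presentation P "nica_rels G P"
    by (rule bounded_presentation_nica)
  let ?g = "universal_gen (semigroup_gens G P) (semigroup_rels G P)"
  have A: "cstar_algebra A" unfolding A_def by (rule SA.cstar_algebra_universal)
  have B: "cstar_algebra B" unfolding B_def by (rule NB.cstar_algebra_universal)
  interpret A: cstar_algebra A by (rule A)
  interpret B: cstar_algebra B by (rule B)
  have g: "?g x \<in> carrier A" if "x \<in> semigroup_gens G P" for x
    unfolding A_def using that by (rule SA.gen_carrier)
  have w: "w p \<in> carrier B" if "p \<in> P" for p
    unfolding B_def w_def using that by (rule NB.gen_carrier)
  have A_rels: "star_eval A ?g r = \<zero>\<^bsub>A\<^esub>" if "r \<in> semigroup_rels G P" for r
    unfolding A_def using that by (rule SA.universal_rels)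
  have B_rels: "star_eval B w r = \<zero>\<^bsub>B\<^esub>" if "r \<in> nica_rels G P" for r
    unfolding B_def w_def using that by (rule NB.universal_rels)
  have v: "v p \<in> carrier A" if "p \<in> P" for p
    using g[of "V p"] that by (simp add: v_def semigroup_gens_def)
  have e_empty: "e {} = \<zero>\<^bsub>A\<^esub>"
    using semigroup_empty[of A ?g, OF A g A_rels] by (simp add: e_def)
  have e_range: "e (p <#\<^bsub>G\<^esub> P) = v p \<otimes>\<^bsub>A\<^esub> star A (v p)" if "p \<in> P" for p
    using semigroup_range[of A ?g, OF A g A_rels that] by (simp add: e_def v_def)
  \<comment> \<open>Values on the isometries fix those on the projections, since each
    \<open>e X\<close> is zero or of the form \<open>v p \<otimes> star A (v p)\<close>.\<close>
  have gens: "\<And>x. x \<in> semigroup_gens G P \<Longrightarrow> \<chi> (?g x) = \<chi>' (?g x)"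
    if "\<chi> \<in> star_hom A C" "\<chi>' \<in> star_hom A C" "cstar_algebra C" "\<And>p. p \<in> P \<Longrightarrow> \<chi> (v p) = \<chi>' (v p)"
    for \<chi> \<chi>' and C :: "'b star_algebra"
  proof -
    fix x assume "x \<in> semigroup_gens G P"
    then consider p where "x = V p" "p \<in> P" | X where "x = E X" "X \<in> constructible_ideals G P"
      by (auto simp: semigroup_gens_def)
    then show "\<chi> (?g x) = \<chi>' (?g x)"
    proof cases
      case 1
      then show ?thesis using that(4) by (simp add: v_def)
    next
      case 2
      from 2(2) show ?thesis
      proof (rule constructible_ideals_cases)
        assume "X = {}"
        then show ?thesis using e_empty star_hom_zero[OF A that(3,1)] star_hom_zero[OF A that(3,2)]
          by (simp add: 2 e_def)
      next
        fix p assume "p \<in> P" "X = p <#\<^bsub>G\<^esub> P"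
        then show ?thesis using e_range[of p] that(4)[of p] v[of p]
          by (simp add: 2 e_def star_hom_mult[OF that(1)] star_hom_mult[OF that(2)]
              star_hom_star[OF that(1)] star_hom_star[OF that(2)])
      qed
    qed
  qed
  \<comment> \<open>The target \<open>C\<close> stays arbitrary: it becomes \<open>A\<close> when a
    composite is compared with the identity, and \<open>B\<close> for the uniqueness of
    \<open>\<phi>\<close>.\<close>
  have uniqA: "\<chi> x = \<chi>' x"
    if "\<chi> \<in> star_hom A C" "\<chi>' \<in> star_hom A C" "cstar_algebra C" "\<And>p. p \<in> P \<Longrightarrow> \<chi> (v p) = \<chi>' (v p)"
      "x \<in> carrier A" for \<chi> \<chi>' x and C :: "'b star_algebra"
    by (rule SA.star_hom_unique[OF that(3) that(1,2)[unfolded A_def] gens[OF that(1-4)]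
      that(5)[unfolded A_def]])
  have uniqB: "\<chi> y = \<chi>' y"
    if "\<chi> \<in> star_hom B C" "\<chi>' \<in> star_hom B C" "cstar_algebra C" "\<And>p. p \<in> P \<Longrightarrow> \<chi> (w p) = \<chi>' (w p)"
      "y \<in> carrier B" for \<chi> \<chi>' y and C :: "'b star_algebra"
    by (rule NB.star_hom_unique[OF that(3) that(1,2)[unfolded B_def] that(4)[unfolded w_def]
      that(5)[unfolded B_def]])

  have assign: "nica_assign B w x \<in> carrier B" if "x \<in> semigroup_gens G P" for x
    using that by (auto simp: semigroup_gens_def nica_assign_def w nica_assign_rels(1)[OF B w B_rels])
  have "\<exists>\<phi>\<in>star_hom A B. \<forall>x\<in>semigroup_gens G P. \<phi> (?g x) = nica_assign B w x"
    unfolding A_def by (rule SA.universal_ex[OF B assign nica_assign_rels(2)[OF B w B_rels]])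
  then obtain \<phi> where \<phi>: "\<phi> \<in> star_hom A B"
    and \<phi>_g: "\<And>x. x \<in> semigroup_gens G P \<Longrightarrow> \<phi> (?g x) = nica_assign B w x"
    by blast
  have \<phi>_v: "\<phi> (v p) = w p" if "p \<in> P" for p
    using \<phi>_g[of "V p"] that by (simp add: v_def semigroup_gens_def nica_assign_def)
  have v_rels: "star_eval A v r = \<zero>\<^bsub>A\<^esub>" if "r \<in> nica_rels G P" for r
    using semigroup_nica_rels[of A ?g, OF A g A_rels that] by (simp add: v_def comp_def)
  have "\<exists>\<psi>\<in>star_hom B A. \<forall>p\<in>P. \<psi> (w p) = v p"
    unfolding B_def w_def by (rule NB.universal_ex[OF A v v_rels])
  then obtain \<psi> where \<psi>: "\<psi> \<in> star_hom B A" and \<psi>_w: "\<And>p. p \<in> P \<Longrightarrow> \<psi> (w p) = v p"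
    by blast

  \<comment> \<open>Each composite fixes the canonical isometries of its algebra, as the identity
    does.\<close>
  have \<psi>\<phi>: "\<psi> (\<phi> x) = x" if "x \<in> carrier A" for x
    using uniqA[OF star_hom_comp[OF \<phi> \<psi>] star_hom_id A _ that] by (simp add: \<phi>_v \<psi>_w)
  have \<phi>\<psi>: "\<phi> (\<psi> y) = y" if "y \<in> carrier B" for y
    using uniqB[OF star_hom_comp[OF \<psi> \<phi>] star_hom_id B _ that] by (simp add: \<phi>_v \<psi>_w)
  have "bij_betw \<phi> (carrier A) (carrier B)"
    by (rule bij_betw_byWitness[of _ \<psi>])
      (use \<psi>\<phi> \<phi>\<psi> star_hom_closed[OF \<phi>] star_hom_closed[OF \<psi>] in auto)
  with \<phi> have iso: "\<phi> \<in> star_iso A B" by (simp add: star_iso_def)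
  show ?thesis
  proof (intro bexI[OF _ iso] bexI[OF _ \<psi>] conjI ballI impI)
    show "\<phi> (e {}) = \<zero>\<^bsub>B\<^esub>" by (simp add: e_empty star_hom_zero[OF A B \<phi>])
    show "\<phi> (e (p <#\<^bsub>G\<^esub> P)) = w p \<otimes>\<^bsub>B\<^esub> star B (w p)" if "p \<in> P" for p
      using that v by (simp add: e_range star_hom_mult[OF \<phi>] star_hom_star[OF \<phi>] \<phi>_v)
  next
    fix \<phi>' x assume \<phi>': "\<phi>' \<in> star_hom A B" and x: "x \<in> carrier A"
      and *: "(\<forall>p\<in>P. \<phi>' (v p) = w p) \<and> \<phi>' (e {}) = \<zero>\<^bsub>B\<^esub> \<and>
        (\<forall>p\<in>P. \<phi>' (e (p <#\<^bsub>G\<^esub> P)) = w p \<otimes>\<^bsub>B\<^esub> star B (w p))"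
    show "\<phi>' x = \<phi> x" by (rule uniqA[OF \<phi>' \<phi> B _ x]) (use * in \<open>simp add: \<phi>_v\<close>)
  next
    fix \<psi>' y assume \<psi>': "\<psi>' \<in> star_hom B A" and y: "y \<in> carrier B"
      and *: "\<forall>p\<in>P. \<psi>' (w p) = v p"
    show "\<psi>' y = \<psi> y" by (rule uniqB[OF \<psi>' \<psi> A _ y]) (use * in \<open>simp add: \<psi>_w\<close>)
  qed (simp_all add: \<phi>_v \<psi>_w \<psi>\<phi> \<phi>\<psi>)
qed

end
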